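(* Let $d\ge2$ and $\tau_0,\ldots,\tau_d>0$. Let $e_0,\ldots,e_d$ be the standard orthonormal basis of $\mathbb R^{d+1}$, consider the simplex $S:=[e_0/\tau_0,\ldots,e_d/\tau_d]\subseteq\mathbb R^{d+1}$, let $k\in\{0,\ldots,d\}$, and let $F:=[e_0/\tau_0,\ldots,e_k/\tau_k]$, a $k$-dimensional face of $S$. Then: (a) For $k\in\{0,\ldots,d-1\}$, the tangent cone of $S$ at $F$ can be represented as a direct orthogonal sum $T(F,S)=L\oplus D$ of the $k$-dimensional lineality space $L$ of $F$ and a pointed cone $D$ isometric to $$C_{d-k}(\tau_0^2+\cdots+\tau_k^2;\ \tau_{k+1}^2,\ldots,\tau_d^2;\ 1,\ldots,1).$$ For $k=d$, the tangent cone $T(F,S)=T(S,S)$ is the lineality space of $S$. (b) For $k\in\{0,\ldots,d-1\}$, the normal cone of $S$ at $F$ is an orthogonal direct sum of a straight line and a cone isometric to $$C_{d-k}(-\tau_0^2-\cdots-\tau_d^2;\ \tau_{k+1}^2,\ldots,\tau_d^2;\ 1,\ldots,1).$$ For $k=d$, the normal cone $N(F,S)=N(S,S)$ is a straight line. (c) The internal angle of $S$ at $F$ is $\beta(F,S)=\mathbf g_{d-k}(-\tau_0^2-\cdots-\tau_d^2;\ \tau_{k+1}^2,\ldots,\tau_d^2;\ 1,\ldots,1)$. (d) The external angle of $S$ at $F$ is $\gamma(F,S)=\mathbf g_{d-k}(\tau_0^2+\cdots+\tau_k^2;\ \tau_{k+1}^2,\ldots,\tau_d^2;\ 1,\ld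ots,1)$.
   Context: $[\ldots]$ denotes the convex hull. For a face $F$ of a polytope $P\subseteq\mathbb R^N$ and $x_0$ in the relative interior of $F$, the tangent cone is $T(F,P)=\{v\in\mathbb R^N:x_0+\varepsilon v\in P\text{ for some }\varepsilon>0\}$ and the normal cone is its polar $N(F,P)=\{v\in\mathbb R^N:\langle v,z-x_0\rangle\le0\text{ for all }z\in P\}$. The lineality space of $F$ (or $S$) is the linear subspace parallel to its affine hull. A cone is pointed if it contains no line. The solid angle of a polyhedral cone $C$ is $\alpha(C)=\mathbb P[\xi\in C]$ with $\xi$ standard Gaussian on the linear hull of $C$; $\beta(F,P):=\alpha(T(F,P))$, $\gamma(F,P):=\alpha(N(F,P))$. Condition on parameters: nonzero real $\lambda_0,\ldots,\lambda_m$ satisfy (A) if all are positive, and (B) if exactly one is negative, all others are positive and $\lambda_0+\cdots+\lambda_m<0$. Orthocentric cone: for $m\in\mathbb N$, $\lambda_0,\ldots,\lambda_m$ satisfying (A) or (B) and $\varepsilon_i\in\{\pm1\}$, $C_m(\lambda_0;\lambda_1,\ldots,\lambda_m;\varepsilon_1,\ldots,\varepsilon_m):=\operatorname{pos}(\varepsilon_1u_1,\ldots,\varepsilon_mu_m)$ (positive hull), where $u_1,\ldots,u_m$ are linearly independent vectors in some $\mathbb R^N$, $N\ge m$, with $\langle u_i,u_j\rangle=\frac1{\lambda_0}+\frac{\delta_{ij}}{\lambda_i}$ for all $i,j$; it is defined up to isometry. Function $\mathbf g_m$: under the same conditions, $\mathbf g_m(\lambda_0;\lambda_1,\ldots,\lambda_m;\varepsilon_1,\ldots,\varepsilon_m):=\mathbb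 P[\varepsilon_1\eta_1<0,\ldots,\varepsilon_m\eta_m<0]$, where $(\eta_1,\ldots,\eta_m)$ is centered Gaussian with covariance matrix $\bigl(\frac1{\lambda_0}+\frac{\delta_{ij}}{\lambda_i}\bigr)_{i,j=1}^m$. Also $\mathbf g_0(\lambda_0):=1$ for all $\lambda_0\in\mathbb R$. *)

theory Defs
  imports "HOL-Probability.Probability"
begin

section \<open>Cones\<close>

text \<open>
  The cones of \<open>P\<close> at \<open>F\<close> use some relative interior point of \<open>F\<close>; the lemmas
  \<open>tangent_cone_eq\<close> and \<open>normal_cone_eq\<close> show that its choice is irrelevant.
\<close>

definition rel_interior_point :: "'a::euclidean_space set \<Rightarrow> 'a" where
  "rel_interior_point F = (SOME x. x \<in> rel_interior F)"

definition tangent_cone :: "'a::euclidean_space set \<Rightarrow> 'a set \<Rightarrow> 'a set" where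
  "tangent_cone F P = {v. \<exists>\<epsilon>>0. rel_interior_point F + \<epsilon> *\<^sub>R v \<in> P}"

definition normal_cone :: "'a::euclidean_space set \<Rightarrow> 'a set \<Rightarrow> 'a set" where
  "normal_cone F P = {v. \<forall>z\<in>P. v \<bullet> (z - rel_interior_point F) \<le> 0}"

lemma rel_interior_prolong:
  fixes x :: "'a::euclidean_space"
  assumes "convex F" "x \<in> rel_interior F" "y \<in> F"
  obtains w t where "w \<in> F" "0 < t" "t < 1" "x = t *\<^sub>R w + (1 - t) *\<^sub>R y"
proof -
  have "F \<noteq> {}"
    using assms by auto
  then obtain e where e: "e > 1" "(1 - e) *\<^sub>R y + e *\<^sub>R x \<in> F"
    using convex_rel_interior_iff[of F x] assms by blast
  have "x = (1 / e) *\<^sub>R ((1 - e) *\<^sub>R y + e *\<^sub>R x) + (1 - 1 / e) *\<^sub>R y"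
    using e(1) by (simp add: algebra_simps diff_divide_distrib)
  with e show thesis
    by (intro that[of "(1 - e) *\<^sub>R y + e *\<^sub>R x" "1 / e"]) auto
qed

lemma rel_interior_point:
  assumes "x \<in> rel_interior F"
  shows "rel_interior_point F \<in> rel_interior F"
  unfolding rel_interior_point_def using assms by (rule someI)

lemma tangent_direction_transfer:
  fixes x :: "'a::euclidean_space"
  assumes "convex P" "convex F" "F \<subseteq> P" "x \<in> rel_interior F" "y \<in> F"
    and "\<epsilon> > 0" "y + \<epsilon> *\<^sub>R v \<in> P"
  shows "\<exists>\<delta>>0. x + \<delta> *\<^sub>R v \<in> P"
proof -
  obtain w t where w: "w \<in> F" "0 < t" "t < 1" "x = t *\<^sub>R w + (1 - t) *\<^sub>R y"
    using rel_interior_prolong[OF assms(2,4,5)] by blast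
  have "t *\<^sub>R w + (1 - t) *\<^sub>R (y + \<epsilon> *\<^sub>R v) \<in> P"
    using w assms by (intro convexD[OF assms(1)]) auto
  moreover have "t *\<^sub>R w + (1 - t) *\<^sub>R (y + \<epsilon> *\<^sub>R v) = x + ((1 - t) * \<epsilon>) *\<^sub>R v"
    by (simp add: w(4) algebra_simps)
  ultimately show ?thesis
    using w assms by (intro exI[of _ "(1 - t) * \<epsilon>"]) auto
qed

lemma normal_transfer:
  fixes x :: "'a::euclidean_space"
  assumes "convex F" "F \<subseteq> P" "x \<in> rel_interior F" "y \<in> F"
    and "\<forall>z\<in>P. v \<bullet> (z - x) \<le> 0"
  shows "\<forall>z\<in>P. v \<bullet> (z - y) \<le> 0"
proof -
  obtain w t where w: "w \<in> F" "0 < t" "t < 1" "x = t *\<^sub>R w + (1 - t) *\<^sub>R y"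
    using rel_interior_prolong[OF assms(1,3,4)] by blast
  have "v \<bullet> (w - x) \<le> 0"
    using w assms by auto
  moreover have "w - x = (1 - t) *\<^sub>R (w - y)" "y - x = - (t *\<^sub>R (w - y))"
    by (simp_all add: w(4) algebra_simps)
  ultimately have "v \<bullet> (y - x) \<ge> 0"
    using w by (simp add: mult_le_0_iff)
  then show ?thesis
    using assms(5) by (force simp: inner_diff_right)
qed

lemma tangent_cone_eq:
  assumes "convex P" "convex F" "F \<subseteq> P" "x \<in> rel_interior F"
  shows "tangent_cone F P = {v. \<exists>\<epsilon>>0. x + \<epsilon> *\<^sub>R v \<in> P}"
proof -
  have "rel_interior_point F \<in> rel_interior F"
    using rel_interior_point assms by blast
  then show ?thesis
    unfolding tangent_cone_def
    using tangent_direction_transfer[OF assms(1-3)] assms(4) rel_interior_subset by blast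
qed

lemma normal_cone_eq:
  assumes "convex F" "F \<subseteq> P" "x \<in> rel_interior F"
  shows "normal_cone F P = {v. \<forall>z\<in>P. v \<bullet> (z - x) \<le> 0}"
proof -
  let ?y = "rel_interior_point F"
  have y: "?y \<in> rel_interior F"
    using rel_interior_point assms by blast
  then have "x \<in> F" "?y \<in> F"
    using assms(3) rel_interior_subset by blast+
  then have "(\<forall>z\<in>P. v \<bullet> (z - ?y) \<le> 0) \<longleftrightarrow> (\<forall>z\<in>P. v \<bullet> (z - x) \<le> 0)" for v
    using normal_transfer[OF assms(1,2) y, of x v]
      normal_transfer[OF assms, of ?y v] by blast
  then show ?thesis
    unfolding normal_cone_def by blast
qed

definition lineality_space :: "'a::euclidean_space set \<Rightarrow> 'a set" where
  "lineality_space F = (THE L. subspace L \<and> affine_parallel (affine hull F) L)"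

definition pointed_cone :: "'a::euclidean_space set \<Rightarrow> bool" where
  "pointed_cone D \<longleftrightarrow> convex_cone D \<and> \<not> (\<exists>x v. v \<noteq> 0 \<and> (\<forall>t. x + t *\<^sub>R v \<in> D))"

definition orthogonal_direct_sum ::
    "'a::euclidean_space set \<Rightarrow> 'a set \<Rightarrow> 'a set \<Rightarrow> bool" where
  "orthogonal_direct_sum C L D \<longleftrightarrow>
     (\<forall>x\<in>L. \<forall>y\<in>D. orthogonal x y) \<and> C = {x + y |x y. x \<in> L \<and> y \<in> D}"

definition isometric_cones ::
    "'a::euclidean_space set \<Rightarrow> 'b::euclidean_space set \<Rightarrow> bool" where
  "isometric_cones D C \<longleftrightarrow>
     (\<exists>f. linear f \<and> (\<forall>x\<in>span D. norm (f x) = norm x) \<and> f ` D = C)"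

section \<open>Orthocentric cones\<close>

text \<open>The sequence \<open>l\<close> lists the parameters \<open>l 0, \<dots>, l m\<close>.\<close>

definition condition_A :: "nat \<Rightarrow> (nat \<Rightarrow> real) \<Rightarrow> bool" where
  "condition_A m l \<longleftrightarrow> (\<forall>i\<in>{0..m}. l i > 0)"

definition condition_B :: "nat \<Rightarrow> (nat \<Rightarrow> real) \<Rightarrow> bool" where
  "condition_B m l \<longleftrightarrow>
     (\<exists>j\<in>{0..m}. l j < 0 \<and> (\<forall>i\<in>{0..m} - {j}. l i > 0)) \<and> (\<Sum>i=0..m. l i) < 0"

text \<open>
  From here on the parameter with index 0 is the separate argument \<open>l0\<close>, and only
  the values of \<open>l\<close> and \<open>eps\<close> at \<open>1, \<dots>, m\<close> matter.
\<close>

definition orthocentric_gram :: "real \<Rightarrow> (nat \<Rightarrow> real) \<Rightarrow> nat \<Rightarrow> nat \<Rightarrow> real" where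
  "orthocentric_gram l0 l i j = 1 / l0 + (if i = j then 1 / l i else 0)"

text \<open>
  Since orthocentric cones are defined up to isometry only, they form a predicate:
  \<open>C\<close> is a realisation of \<open>C\<^sub>m(l0; l 1, \<dots>, l m; eps 1, \<dots>, eps m)\<close> in the space \<open>'a\<close>.
\<close>

definition orthocentric_cone ::
    "nat \<Rightarrow> real \<Rightarrow> (nat \<Rightarrow> real) \<Rightarrow> (nat \<Rightarrow> real) \<Rightarrow> 'a::euclidean_space set \<Rightarrow> bool" where
  "orthocentric_cone m l0 l eps C \<longleftrightarrow>
     m \<ge> 1 \<and> (condition_A m (l(0 := l0)) \<or> condition_B m (l(0 := l0))) \<and>
     (\<forall>i\<in>{1..m}. eps i \<in> {1, -1}) \<and>
     (\<exists>u :: nat \<Rightarrow> 'a.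
        inj_on u {1..m} \<and> independent (u ` {1..m}) \<and>
        (\<forall>i\<in>{1..m}. \<forall>j\<in>{1..m}. u i \<bullet> u j = orthocentric_gram l0 l i j) \<and>
        C = convex_cone hull ((\<lambda>i. eps i *\<^sub>R u i) ` {1..m}))"

section \<open>Gaussian laws and angles\<close>

definition centered_normal :: "real \<Rightarrow> real measure" where
  "centered_normal v =
     (if v = 0 then return borel 0
      else density lborel (\<lambda>x. ennreal (normal_density 0 (sqrt v) x)))"

text \<open>
  A law is multivariate Gaussian iff all its linear functionals are normally
  distributed (possibly degenerate); together with the mean and the covariance this
  determines the law, so the definite descriptions below are proper.
\<close>

definition is_centered_gaussian ::
    "'i set \<Rightarrow> ('i \<Rightarrow> 'i \<Rightarrow> real) \<Rightarrow> ('i \<Rightarrow> real) measure \<Rightarrow> bool" where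
  "is_centered_gaussian I \<Sigma> M \<longleftrightarrow>
     prob_space M \<and> sets M = sets (Pi\<^sub>M I (\<lambda>_. borel :: real measure)) \<and>
     (\<forall>t. distr M borel (\<lambda>x. \<Sum>i\<in>I. t i * x i) =
            centered_normal (\<Sum>i\<in>I. \<Sum>j\<in>I. t i * t j * \<Sigma> i j))"

definition centered_gaussian ::
    "'i set \<Rightarrow> ('i \<Rightarrow> 'i \<Rightarrow> real) \<Rightarrow> ('i \<Rightarrow> real) measure" where
  "centered_gaussian I \<Sigma> = (THE M. is_centered_gaussian I \<Sigma> M)"

definition is_std_gaussian_on :: "'a::euclidean_space set \<Rightarrow> 'a measure \<Rightarrow> bool" where
  "is_std_gaussian_on V M \<longleftrightarrow>
     prob_space M \<and> sets M = sets borel \<and> (AE x in M. x \<in> V) \<and>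
     (\<forall>a\<in>V. distr M borel (\<lambda>x. a \<bullet> x) = centered_normal ((norm a)\<^sup>2))"

definition std_gaussian_on :: "'a::euclidean_space set \<Rightarrow> 'a measure" where
  "std_gaussian_on V = (THE M. is_std_gaussian_on V M)"

definition solid_angle :: "'a::euclidean_space set \<Rightarrow> real" where
  "solid_angle C = measure (std_gaussian_on (span C)) C"

definition internal_angle :: "'a::euclidean_space set \<Rightarrow> 'a set \<Rightarrow> real" where
  "internal_angle F P = solid_angle (tangent_cone F P)"

definition external_angle :: "'a::euclidean_space set \<Rightarrow> 'a set \<Rightarrow> real" where
  "external_angle F P = solid_angle (normal_cone F P)"

text \<open>Meaningful for parameters satisfying condition (A) or (B) and signs \<open>eps i\<close>, as for the cones.\<close>

definition g_fun :: "nat \<Rightarrow> real \<Rightarrow> (nat \<Rightarrow> real) \<Rightarrow> (nat \<Rightarrow> real) \<Rightarrow> real" where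
  "g_fun m l0 l eps =
     (if m = 0 then 1
      else let M = centered_gaussian {1..m} (orthocentric_gram l0 l)
           in measure M {x \<in> space M. \<forall>i\<in>{1..m}. eps i * x i < 0})"

end

theory Submission
  imports Defs
begin

text \<open>
  Write \<open>v\<^sub>i = e\<^sub>i/\<tau>\<^sub>i\<close>, \<open>w = \<Sum>\<^sub>i \<tau>\<^sub>i e\<^sub>i\<close>, \<open>\<sigma> = |w|\<^sup>2\<close>, \<open>s = \<Sum>\<^sub>i\<^sub>\<le>\<^sub>k \<tau>\<^sub>i\<^sup>2\<close>, and let
  \<open>x\<^sub>0 = s\<^sup>-\<^sup>1 \<Sum>\<^sub>i\<^sub>\<le>\<^sub>k \<tau>\<^sub>i e\<^sub>i\<close>, a relative interior point of \<open>F\<close>. Modulo its lineality space the tangent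
  cone is generated by \<open>v\<^sub>j - x\<^sub>0\<close>, and the normal cone by \<open>w/\<sigma> - v\<^sub>j\<close> (\<open>j > k\<close>); their Gram
  matrices are the orthocentric ones with \<open>\<lambda>\<^sub>0 = s\<close> and \<open>\<lambda>\<^sub>0 = - \<sigma>\<close>. The two families are biorthogonal up to
  negative factors, so each cone is cut out of its linear span by the inequalities
  \<open>\<langle>u, \<cdot>\<rangle> \<le> 0\<close>, \<open>u\<close> ranging over the generators of the other one. Hence the solid angle of one cone is the
  Gaussian orthant probability whose covariance is the Gram matrix of the other.

  That the measures defined by definite description are the expected images of a standard Gaussian
  needs the Cramer-Wold theorem. It is reduced to the one-dimensional uniqueness
  theorem for characteristic functions by replacing the factors \<open>exp(i t x)\<close> by indicators
  one coordinate at a time.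
\<close>

section \<open>The Cramer-Wold theorem\<close>

text \<open>\<open>D\<close> is the image under \<open>X\<close> of the measure with density
  \<open>h / c\<close> with respect to \<open>M\<close>. Dividing by the total mass \<open>c\<close>
  makes it a probability measure, as the uniqueness theorem for characteristic functions
  requires.\<close>

lemma weighted_law:
  fixes X h :: "'a \<Rightarrow> real"
  assumes h: "integrable M h" "\<And>x. 0 \<le> h x" and X[measurable]: "X \<in> borel_measurable M"
    and c: "c = (LINT x|M. h x)" "c > 0"
  obtains D where "real_distribution D"
    and "\<And>t. char D t = (CLINT x|M. of_real (h x) * iexp (t * X x)) / of_real c"
    and "\<And>A. A \<in> sets borel \<Longrightarrow> measure D A = (LINT x|M. h x * indicator A (X x)) / c"
proof
  let ?E = "density M (\<lambda>x. ennreal (h x / c))"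
  let ?D = "distr ?E borel X"
  have [measurable]: "h \<in> borel_measurable M"
    using h by auto
  have "emeasure ?E (space ?E) = (\<integral>\<^sup>+ x. ennreal (h x / c) \<partial>M)"
    by (simp add: emeasure_density cong: nn_integral_cong)
  also have "\<dots> = ennreal (LINT x|M. h x / c)"
    using h c(2) by (intro nn_integral_eq_integral) auto
  also have "\<dots> = 1"
    using c by simp
  finally have E: "prob_space ?E"
    by (rule prob_spaceI)
  then interpret E: prob_space ?E .
  have "prob_space ?D"
    by (rule E.prob_space_distr) simp
  then show "real_distribution ?D"
    by (simp add: real_distribution_def real_distribution_axioms_def)
  show "char ?D t = (CLINT x|M. of_real (h x) * iexp (t * X x)) / of_real c" for t
  proof -
    have "char ?D t = (CLINT x|?E. iexp (t * X x))"
      unfolding char_def by (rule integral_distr) simp_all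
    also have "\<dots> = (CLINT x|M. (h x / c) *\<^sub>R iexp (t * X x))"
      using h c(2) by (intro integral_density) auto
    also have "\<dots> = (CLINT x|M. (of_real (h x) * iexp (t * X x)) / of_real c)"
      by (simp add: scaleR_conv_of_real)
    finally show ?thesis
      by simp
  qed
  show "measure ?D A = (LINT x|M. h x * indicator A (X x)) / c" if [measurable]: "A \<in> sets borel" for A
  proof -
    have "measure ?D A = (LINT x|?D. indicator A x)"
      by simp
    also have "\<dots> = (LINT x|?E. indicator A (X x))"
      by (rule integral_distr) simp_all
    also have "\<dots> = (LINT x|M. (h x / c) *\<^sub>R indicator A (X x))"
      using h c(2) by (intro integral_density) auto
    finally show ?thesis
      by simp
  qed
qed

text \<open>After normalisation the hypothesis says that two characteristic functions agree, so
  \<open>Levy_uniqueness\<close> applies. The hypothesis at \<open>t = 0\<close> shows that the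
  total masses coincide; if they are 0, both weights vanish almost everywhere and so do both
  integrals.\<close>

lemma weighted_law_unique:
  fixes X h :: "'a \<Rightarrow> real" and Y g :: "'b \<Rightarrow> real"
  assumes h: "integrable M h" "\<And>x. 0 \<le> h x" and X: "X \<in> borel_measurable M"
    and g: "integrable N g" "\<And>x. 0 \<le> g x" and Y: "Y \<in> borel_measurable N"
    and char: "\<And>t. (CLINT x|M. of_real (h x) * iexp (t * X x)) =
                     (CLINT x|N. of_real (g x) * iexp (t * Y x))"
    and A: "A \<in> sets borel"
  shows "(LINT x|M. h x * indicator A (X x)) = (LINT x|N. g x * indicator A (Y x))"
proof -
  define c where "c = (LINT x|M. h x)"
  have c': "c = (LINT x|N. g x)"
    using char[of 0] by (simp add: c_def)
  have "c \<ge> 0"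
    using h(2) by (simp add: c_def)
  show ?thesis
  proof (cases "c = 0")
    case True
    then have "AE x in M. h x = 0" "AE x in N. g x = 0"
      using integral_nonneg_eq_0_iff_AE[OF h(1)] h(2) integral_nonneg_eq_0_iff_AE[OF g(1)] g(2) c' c_def
      by simp_all
    then have "AE x in M. h x * indicator A (X x) = 0" "AE x in N. g x * indicator A (Y x) = 0"
      by auto
    then show ?thesis
      by (simp add: integral_eq_zero_AE)
  next
    case False
    with \<open>c \<ge> 0\<close> have "c > 0"
      by simp
    obtain D where D: "real_distribution D"
      "\<And>t. char D t = (CLINT x|M. of_real (h x) * iexp (t * X x)) / of_real c"
      "\<And>A. A \<in> sets borel \<Longrightarrow> measure D A = (LINT x|M. h x * indicator A (X x)) / c"
      using weighted_law[OF h X c_def \<open>c > 0\<close>] by blast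
    obtain E where E: "real_distribution E"
      "\<And>t. char E t = (CLINT x|N. of_real (g x) * iexp (t * Y x)) / of_real c"
      "\<And>A. A \<in> sets borel \<Longrightarrow> measure E A = (LINT x|N. g x * indicator A (Y x)) / c"
      using weighted_law[OF g Y c' \<open>c > 0\<close>] by blast
    have "D = E"
      using D E char by (intro Levy_uniqueness) auto
    with D(3)[OF A] E(3)[OF A] \<open>c > 0\<close> show ?thesis
      by simp
  qed
qed

section \<open>From one coordinate to joint laws\<close>

lemma cos_iexp: "complex_of_real (cos x) = (iexp x + iexp (- x)) / 2"
  by (simp add: cos_exp_eq cos_of_real[symmetric])

lemma integrable_bounded_complex:
  fixes f :: "'a \<Rightarrow> complex"
  assumes "prob_space M" "f \<in> borel_measurable M" "\<And>x. norm (f x) \<le> B"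
  shows "integrable M f"
proof -
  interpret prob_space M by fact
  show ?thesis
    using assms by (intro integrable_const_bound[where B = B]) auto
qed

text \<open>Induction over the set \<open>J\<close> of coordinates whose events have already entered
  as indicators. The induction claim keeps the exponential of an arbitrary linear combination over
  all of \<open>I\<close>, so that further exponents can be absorbed into \<open>t\<close>. The
  claim for \<open>J = I\<close> at \<open>t = 0\<close> is the assertion.\<close>

lemma joint_law_unique:
  fixes X :: "'i \<Rightarrow> 'a \<Rightarrow> real" and Y :: "'i \<Rightarrow> 'b \<Rightarrow> real"
  assumes M: "prob_space M" and N: "prob_space N" and I: "finite I"
    and X: "\<And>i. i \<in> I \<Longrightarrow> X i \<in> borel_measurable M"
    and Y: "\<And>i. i \<in> I \<Longrightarrow> Y i \<in> borel_measurable N"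
    and char: "\<And>t :: 'i \<Rightarrow> real. (CLINT x|M. iexp (\<Sum>i\<in>I. t i * X i x)) = (CLINT x|N. iexp (\<Sum>i\<in>I. t i * Y i x))"
    and A: "\<And>i. i \<in> I \<Longrightarrow> A i \<in> sets borel"
  shows "measure M {x\<in>space M. \<forall>i\<in>I. X i x \<in> A i} = measure N {x\<in>space N. \<forall>i\<in>I. Y i x \<in> A i}"
proof -
  interpret M: prob_space M by fact
  interpret N: prob_space N by fact
  define p where "p J x = (\<Prod>j\<in>J. indicator (A j) (X j x) :: real)" for J x
  define q where "q J x = (\<Prod>j\<in>J. indicator (A j) (Y j x) :: real)" for J x
  define \<xi> where "\<xi> t x = (\<Sum>i\<in>I. t i * X i x)" for t x
  define \<eta> where "\<eta> t x = (\<Sum>i\<in>I. t i * Y i x)" for t x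
  have p01: "0 \<le> p J x" "p J x \<le> 1" and q01: "0 \<le> q J y" "q J y \<le> 1" for J x y
    by (auto simp: p_def q_def intro!: prod_nonneg prod_le_1)
  have [measurable]: "\<xi> t \<in> borel_measurable M" for t
    using X unfolding \<xi>_def by (intro borel_measurable_sum borel_measurable_times) auto
  have [measurable]: "\<eta> t \<in> borel_measurable N" for t
    using Y unfolding \<eta>_def by (intro borel_measurable_sum borel_measurable_times) auto
  have pm: "p J \<in> borel_measurable M" if "J \<subseteq> I" for J
    unfolding p_def using that A X
    by (intro borel_measurable_prod borel_measurable_indicator' measurable_sets) (auto simp: measurable_If)
  have qm: "q J \<in> borel_measurable N" if "J \<subseteq> I" for J
    unfolding q_def using that A Y
    by (intro borel_measurable_prod borel_measurable_indicator') auto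
  have "finite J \<Longrightarrow> J \<subseteq> I \<Longrightarrow> \<forall>t. (CLINT x|M. of_real (p J x) * iexp (\<xi> t x)) = (CLINT x|N. of_real (q J x) * iexp (\<eta> t x))" for J
  proof (induction J rule: finite_induct)
    case empty
    then show ?case
      using char by (simp add: p_def q_def \<xi>_def \<eta>_def)
  next
    case (insert k J)
    then have [simp]: "k \<in> I" "J \<subseteq> I" and kJ: "insert k J \<subseteq> I"
      by auto
    have [measurable]: "p J \<in> borel_measurable M" "q J \<in> borel_measurable N"
      "p (insert k J) \<in> borel_measurable M" "q (insert k J) \<in> borel_measurable N"
      "X k \<in> borel_measurable M" "Y k \<in> borel_measurable N" "A k \<in> sets borel"
      using X Y A pm qm kJ by auto
    have IH: "(CLINT x|M. of_real (p J x) * iexp (\<xi> t x)) = (CLINT x|N. of_real (q J x) * iexp (\<eta> t x))" for t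
      using insert by auto
    have \<xi>_add: "\<xi> s x + \<xi> t x = \<xi> (\<lambda>i. s i + t i) x" "\<eta> s y + \<eta> t y = \<eta> (\<lambda>i. s i + t i) y" for s t x y
      by (simp_all add: \<xi>_def \<eta>_def sum.distrib ring_distribs)
    have \<xi>_neg: "- \<xi> t x = \<xi> (\<lambda>i. - t i) x" "- \<eta> t y = \<eta> (\<lambda>i. - t i) y" for t x y
      by (simp_all add: \<xi>_def \<eta>_def sum_negf)
    \<comment> \<open>Expanding the cosine gives three exponentials; once each exponent is again of
      the form \<xi> or \<eta>, the induction hypothesis applies to every term.\<close>
    have split: "complex_of_real (a * (1 + cos (b + \<phi>))) * iexp r =
        a * iexp r + (iexp \<phi> / 2 * (a * iexp (r + b)) + iexp (- \<phi>) / 2 * (a * iexp (r + - b)))" for a b \<phi> r :: real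
    proof -
      have h: "complex_of_real (1 + cos (b + \<phi>)) = 1 + (iexp (b + \<phi>) + iexp (- (b + \<phi>))) / 2"
        using cos_iexp[of "b + \<phi>"] by simp
      have e: "iexp (b + \<phi>) = iexp \<phi> * iexp b" "iexp (- (b + \<phi>)) = iexp (- \<phi>) * iexp (- b)"
        "iexp (r + b) = iexp r * iexp b" "iexp (r + - b) = iexp r * iexp (- b)"
        unfolding exp_add[symmetric] by (simp_all add: algebra_simps)
      have alg: "a * (1 + (p * b + p' * b') / 2) * r = a * r + (p / 2 * (a * (r * b)) + p' / 2 * (a * (r * b')))"
        for a p b p' b' r :: complex
        by (simp add: field_simps)
      show ?thesis
        by (simp only: of_real_mult h e alg)
    qed
    have intM: "integrable M (\<lambda>x. of_real (p J x) * iexp (f x))" if "f \<in> borel_measurable M" for f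
      using that p01 by (intro integrable_bounded_complex[OF M, of _ 1]) (auto simp: norm_mult)
    have intN: "integrable N (\<lambda>x. of_real (q J x) * iexp (f x))" if "f \<in> borel_measurable N" for f
      using that q01 by (intro integrable_bounded_complex[OF N, of _ 1]) (auto simp: norm_mult)
    \<comment> \<open>The one-dimensional theorem needs nonnegative weights, so the remaining coordinates
      enter through \<open>1 + cos\<close> with a phase instead of \<open>exp\<close>.\<close>
    have w: "(LINT x|M. (p J x * (1 + cos (\<xi> t x + \<phi>))) * indicator (A k) (X k x)) =
             (LINT x|N. (q J x * (1 + cos (\<eta> t x + \<phi>))) * indicator (A k) (Y k x))" for t \<phi>
    proof (rule weighted_law_unique)
      have b: "\<bar>a * (1 + cos r)\<bar> \<le> 2" if "0 \<le> a" "a \<le> 1" for a r :: real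
      proof -
        have "\<bar>1 + cos r\<bar> \<le> 2"
          by (smt (verit) cos_le_one cos_ge_minus_one)
        then have "\<bar>a\<bar> * \<bar>1 + cos r\<bar> \<le> 1 * 2"
          using that by (intro mult_mono) auto
        then show ?thesis
          by (simp add: abs_mult)
      qed
      have nn: "0 \<le> a * (1 + cos r)" if "0 \<le> a" for a r :: real
        using that by (smt (verit) cos_ge_minus_one mult_nonneg_nonneg)
      show "integrable M (\<lambda>x. p J x * (1 + cos (\<xi> t x + \<phi>)))"
        using b[OF p01] by (intro M.integrable_const_bound[of _ 2]) auto
      show "integrable N (\<lambda>x. q J x * (1 + cos (\<eta> t x + \<phi>)))"
        using b[OF q01] by (intro N.integrable_const_bound[of _ 2]) auto
      show "0 \<le> p J x * (1 + cos (\<xi> t x + \<phi>))" "0 \<le> q J y * (1 + cos (\<eta> t y + \<phi>))" for x y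
        by (simp_all add: nn p01 q01)
      fix s
      \<comment> \<open>The new exponent in coordinate \<open>k\<close> is itself a linear
        combination, supported at \<open>k\<close>, and therefore merges with \<open>\<xi> t\<close>
        and \<open>\<eta> t\<close>.\<close>
      define t0 where "t0 = (\<lambda>i. 0 :: real)(k := s)"
      have t0: "s * X k x = \<xi> t0 x" "s * Y k y = \<eta> t0 y" for x y
        using I by (simp_all add: \<xi>_def \<eta>_def t0_def sum.remove[of I k])
      show "(CLINT x|M. of_real (p J x * (1 + cos (\<xi> t x + \<phi>))) * iexp (s * X k x)) =
            (CLINT x|N. of_real (q J x * (1 + cos (\<eta> t x + \<phi>))) * iexp (s * Y k x))"
        unfolding split
        by (simp add: intM intN del: of_real_add of_real_minus of_real_mult of_real_diff add_uminus_conv_diff)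
          (simp add: \<xi>_neg \<xi>_add IH t0 del: of_real_add of_real_minus of_real_mult of_real_diff add_uminus_conv_diff)
    qed simp_all
    have iM: "integrable M (\<lambda>x. p (insert k J) x * f x)" if "f \<in> borel_measurable M" "\<And>x. \<bar>f x\<bar> \<le> 1" for f
      using that p01[of "insert k J"] by (intro M.integrable_const_bound[of _ 1]) (auto simp: abs_mult intro!: mult_le_one)
    have iN: "integrable N (\<lambda>x. q (insert k J) x * f x)" if "f \<in> borel_measurable N" "\<And>x. \<bar>f x\<bar> \<le> 1" for f
      using that q01[of "insert k J"] by (intro N.integrable_const_bound[of _ 1]) (auto simp: abs_mult intro!: mult_le_one)
    have iM1: "integrable M (p (insert k J))" and iN1: "integrable N (q (insert k J))"
      using iM[of "\<lambda>_. 1"] iN[of "\<lambda>_. 1"] by simp_all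
    have pq: "p J x * a * indicator (A k) (X k x) = p (insert k J) x * a"
         "q J y * a * indicator (A k) (Y k y) = q (insert k J) y * a" for x y a
      using insert by (simp_all add: p_def q_def)
    have w': "(LINT x|M. p (insert k J) x * 1) + (LINT x|M. p (insert k J) x * cos (\<xi> t x + \<phi>)) =
             (LINT x|N. q (insert k J) x * 1) + (LINT x|N. q (insert k J) x * cos (\<eta> t x + \<phi>))" for t \<phi>
      using w[of t \<phi>] unfolding pq ring_distribs
      by (subst (asm) (1 2) Bochner_Integration.integral_add) (auto intro!: iM iN iM1 iN1)
    \<comment> \<open>At \<open>t = 0\<close> and \<phi> = 0 the cosine is 1 and \<open>w'\<close>
      compares doubled integrals. This identifies the constant terms, which then cancel from
      \<open>w'\<close>.\<close>
    have w1: "(LINT x|M. p (insert k J) x * 1) = (LINT x|N. q (insert k J) x * 1)"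
      using w'[of "\<lambda>_. 0" 0] by (simp add: \<xi>_def \<eta>_def)
    have cs: "(LINT x|M. p (insert k J) x * cos (\<xi> t x + \<phi>)) = (LINT x|N. q (insert k J) x * cos (\<eta> t x + \<phi>))" for t \<phi>
      using w'[of t \<phi>] unfolding w1 by (rule add_left_imp_eq)
    have sn: "sin r = cos (r + - (pi / 2))" for r :: real
      by (simp add: cos_diff)
    \<comment> \<open>The phases 0 and \<open>- (pi / 2)\<close> produce the cosine and the sine, so
      \<open>cs\<close> controls the real and the imaginary part.\<close>
    have iexp_split: "complex_of_real a * iexp r = of_real (a * cos (r + 0)) + \<i> * of_real (a * cos (r + - (pi / 2)))" for a r
      unfolding sn[symmetric] by (simp add: exp_Euler cos_of_real sin_of_real ring_distribs)
    have "(CLINT x|M. of_real (p (insert k J) x) * iexp (\<xi> t x)) =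
        of_real (LINT x|M. p (insert k J) x * cos (\<xi> t x + 0)) +
        \<i> * of_real (LINT x|M. p (insert k J) x * cos (\<xi> t x + - (pi / 2)))" for t
      unfolding iexp_split
      by (subst Bochner_Integration.integral_add)
        (auto intro!: iM integrable_mult_right integrable_of_real simp del: of_real_mult add_uminus_conv_diff)
    moreover have "(CLINT x|N. of_real (q (insert k J) x) * iexp (\<eta> t x)) =
        of_real (LINT x|N. q (insert k J) x * cos (\<eta> t x + 0)) +
        \<i> * of_real (LINT x|N. q (insert k J) x * cos (\<eta> t x + - (pi / 2)))" for t
      unfolding iexp_split
      by (subst Bochner_Integration.integral_add)
        (auto intro!: iN integrable_mult_right integrable_of_real simp del: of_real_mult add_uminus_conv_diff)
    ultimately show ?case
      by (simp only: cs simp_thms)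
  qed
  from this[OF I order_refl] have "(CLINT x|M. of_real (p I x)) = (CLINT x|N. of_real (q I x))"
    by (auto simp: \<xi>_def \<eta>_def dest!: spec[where x = "\<lambda>_. 0"])
  then have "(LINT x|M. p I x) = (LINT x|N. q I x)"
    by simp
  moreover have "(LINT x|M. p I x) = measure M {x\<in>space M. \<forall>i\<in>I. X i x \<in> A i}"
  proof -
    have "(LINT x|M. p I x) = (LINT x|M. indicator {x\<in>space M. \<forall>i\<in>I. X i x \<in> A i} x)"
      by (intro Bochner_Integration.integral_cong) (use I in \<open>auto simp: p_def indicator_def\<close>)
    then show ?thesis
      by (simp add: Int_absorb2 Collect_conj_eq)
  qed
  moreover have "(LINT x|N. q I x) = measure N {x\<in>space N. \<forall>i\<in>I. Y i x \<in> A i}"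
  proof -
    have "(LINT x|N. q I x) = (LINT x|N. indicator {x\<in>space N. \<forall>i\<in>I. Y i x \<in> A i} x)"
      by (intro Bochner_Integration.integral_cong) (use I in \<open>auto simp: q_def indicator_def\<close>)
    then show ?thesis
      by (simp add: Int_absorb2 Collect_conj_eq)
  qed
  ultimately show ?thesis
    by simp
qed

section \<open>Cramer-Wold on product and Euclidean spaces\<close>

lemma char_distr_eq:
  assumes f: "f \<in> borel_measurable M" and g: "g \<in> borel_measurable N"
    and eq: "distr M borel f = distr N borel g"
  shows "(CLINT x|M. iexp (f x)) = (CLINT x|N. iexp (g x))"
proof -
  have "(CLINT x|M. iexp (f x)) = (CLINT x|distr M borel f. iexp x)"
    using f by (subst integral_distr) auto
  also have "\<dots> = (CLINT x|N. iexp (g x))"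
    unfolding eq using g by (subst integral_distr) auto
  finally show ?thesis .
qed

text \<open>Equal laws of the linear functionals give equal characteristic functions, so
  \<open>joint_law_unique\<close> yields agreement on boxes, which determine a finite measure on the
  product. The exhausting sequence can be constant because both measures are finite.\<close>

lemma cramer_wold_PiM:
  fixes M N :: "('i \<Rightarrow> real) measure"
  assumes I: "finite I" and M: "prob_space M" and N: "prob_space N"
    and sM[measurable_cong]: "sets M = sets (Pi\<^sub>M I (\<lambda>_. borel))"
    and sN[measurable_cong]: "sets N = sets (Pi\<^sub>M I (\<lambda>_. borel))"
    and eq: "\<And>t. distr M borel (\<lambda>x. \<Sum>i\<in>I. t i * x i) = distr N borel (\<lambda>x. \<Sum>i\<in>I. t i * x i)"
  shows "M = N"
proof (rule measure_eqI_PiM_finite[OF I sM sN, where A = "\<lambda>_. Pi\<^sub>E I (\<lambda>_. UNIV)"])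
  interpret M: prob_space M by fact
  interpret N: prob_space N by fact
  have sp: "space M = Pi\<^sub>E I (\<lambda>_. UNIV)" "space N = Pi\<^sub>E I (\<lambda>_. UNIV)"
    using sets_eq_imp_space_eq[OF sM] sets_eq_imp_space_eq[OF sN] by (simp_all add: space_PiM)
  fix A :: "'i \<Rightarrow> real set"
  assume A: "\<And>i. i \<in> I \<Longrightarrow> A i \<in> sets borel"
  have "measure M {x\<in>space M. \<forall>i\<in>I. x i \<in> A i} = measure N {x\<in>space N. \<forall>i\<in>I. x i \<in> A i}"
  proof (rule joint_law_unique[OF M N I _ _ _ A])
    show "(CLINT x|M. iexp (\<Sum>i\<in>I. t i * x i)) = (CLINT x|N. iexp (\<Sum>i\<in>I. t i * x i))" for t
      by (rule char_distr_eq[OF _ _ eq]) simp_all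
  qed simp_all
  moreover have "{x\<in>Pi\<^sub>E I (\<lambda>_. UNIV). \<forall>i\<in>I. x i \<in> A i} = Pi\<^sub>E I A"
    by auto
  ultimately show "emeasure M (Pi\<^sub>E I A) = emeasure N (Pi\<^sub>E I A)"
    by (simp add: sp M.emeasure_eq_measure N.emeasure_eq_measure)
next
  interpret M: prob_space M by fact
  show "range (\<lambda>_. Pi\<^sub>E I (\<lambda>_. UNIV)) \<subseteq> prod_algebra I (\<lambda>_. borel :: real measure)"
    using I by (auto intro!: prod_algebraI_finite)
  show "emeasure M (Pi\<^sub>E I (\<lambda>_. UNIV)) \<noteq> \<infinity>"
    by simp
qed (simp add: space_PiM)

lemma coordinates_measurable [measurable]:
  "(\<lambda>x :: 'a :: euclidean_space. \<lambda>b\<in>Basis. x \<bullet> b) \<in> borel \<rightarrow>\<^sub>M Pi\<^sub>M Basis (\<lambda>_. borel)"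
  "(\<lambda>f. \<Sum>b\<in>Basis. f b *\<^sub>R b :: 'a) \<in> Pi\<^sub>M Basis (\<lambda>_. borel) \<rightarrow>\<^sub>M borel"
  by measurable

text \<open>Passing to coordinates turns \<open>a \<bullet> x\<close> into a linear combination of
  coordinates, which reduces the claim to the product space; the inverse map carries the equality
  back.\<close>

lemma cramer_wold_euclidean:
  fixes M N :: "'a :: euclidean_space measure"
  assumes M: "prob_space M" and N: "prob_space N"
    and sM[measurable_cong]: "sets M = sets borel"
    and sN[measurable_cong]: "sets N = sets borel"
    and eq: "\<And>a. distr M borel (\<lambda>x. a \<bullet> x) = distr N borel (\<lambda>x. a \<bullet> x)"
  shows "M = N"
proof -
  let ?P = "Pi\<^sub>M Basis (\<lambda>_::'a. borel :: real measure)"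
  let ?c = "\<lambda>x :: 'a. \<lambda>b\<in>Basis. x \<bullet> b" and ?r = "\<lambda>f. \<Sum>b\<in>Basis. f b *\<^sub>R b :: 'a"
  have "distr M ?P ?c = distr N ?P ?c"
  proof (rule cramer_wold_PiM[OF finite_Basis])
    have lin: "(\<Sum>b\<in>Basis. t b * (x \<bullet> b)) = (\<Sum>b\<in>Basis. t b *\<^sub>R b) \<bullet> x" for t and x :: 'a
      by (simp add: inner_sum_left inner_commute[of x])
    show "distr (distr M ?P ?c) borel (\<lambda>x. \<Sum>i\<in>Basis. t i * x i) =
          distr (distr N ?P ?c) borel (\<lambda>x. \<Sum>i\<in>Basis. t i * x i)" for t
      using eq[of "\<Sum>b\<in>Basis. t b *\<^sub>R b"] by (simp add: distr_distr comp_def lin)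
  qed (simp_all add: M N prob_space.prob_space_distr)
  then have "distr (distr M ?P ?c) borel ?r = distr (distr N ?P ?c) borel ?r"
    by simp
  then have "distr M borel (\<lambda>x. x) = distr N borel (\<lambda>x. x)"
    by (simp add: distr_distr comp_def euclidean_representation)
  then show ?thesis
    by (simp add: distr_id2 sM sN)
qed

section \<open>Gaussian measures and solid angles\<close>

lemma sets_centered_normal [simp, measurable_cong]: "sets (centered_normal v) = sets borel"
  by (simp add: centered_normal_def)

lemma prob_space_centered_normal: "v \<ge> 0 \<Longrightarrow> prob_space (centered_normal v)"
  by (auto simp: centered_normal_def prob_space_return intro!: prob_space_normal_density)

lemma measure_centered_normal_0:
  assumes "v > 0"
  shows "measure (centered_normal v) {0} = 0"
proof -
  have "emeasure (centered_normal v) {0} = 0"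
    using assms by (simp add: centered_normal_def emeasure_density_const emeasure_density nn_integral_indicator_singleton)
  then show ?thesis
    by (simp add: measure_def)
qed

text \<open>An explicit model with independent standard normal coordinates. Its images supply the
  existence half of the definite descriptions \<open>centered_gaussian\<close> and
  \<open>std_gaussian_on\<close>.\<close>

definition std_gaussian :: "'a::euclidean_space measure" where
  "std_gaussian = distr (Pi\<^sub>M Basis (\<lambda>_. centered_normal 1)) borel (\<lambda>f. \<Sum>b\<in>Basis. f b *\<^sub>R b)"

lemma sets_std_gaussian [simp, measurable_cong]: "sets std_gaussian = sets borel"
  by (simp add: std_gaussian_def)

lemma space_std_gaussian [simp]: "space std_gaussian = UNIV"
  by (simp add: std_gaussian_def)

lemma prob_space_std_gaussian: "prob_space (std_gaussian :: 'a::euclidean_space measure)"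
  unfolding std_gaussian_def
  by (intro prob_space.prob_space_distr prob_space_PiM prob_space_centered_normal) measurable

lemma distr_std_gaussian:
  fixes a :: "'a::euclidean_space"
  shows "distr std_gaussian borel (\<lambda>x. a \<bullet> x) = centered_normal ((norm a)\<^sup>2)"
proof (cases "a = 0")
  case True
  interpret prob_space "std_gaussian :: 'a measure"
    by (rule prob_space_std_gaussian)
  show ?thesis
    using True by (simp add: centered_normal_def)
next
  case False
  define P where "P = Pi\<^sub>M Basis (\<lambda>_::'a. centered_normal 1)"
  interpret prob_space P
    unfolding P_def by (intro prob_space_PiM prob_space_centered_normal) simp
  have sP[measurable_cong]: "sets P = sets (Pi\<^sub>M Basis (\<lambda>_. borel))"
    unfolding P_def by (intro sets_PiM_cong) simp_all
  have coord: "distr P borel (\<lambda>f. f b) = centered_normal 1" if "b \<in> Basis" for b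
  proof -
    have "distr P borel (\<lambda>f. f b) = distr P (centered_normal 1) (\<lambda>f. f b)"
      by (intro distr_cong) simp_all
    also have "\<dots> = centered_normal 1"
      unfolding P_def using that by (intro distr_PiM_component prob_space_centered_normal) simp_all
    finally show ?thesis .
  qed
  have "indep_vars (\<lambda>_. borel) (\<lambda>b f. f b) (Basis :: 'a set)"
  proof (subst indep_vars_iff_distr_eq_PiM')
    \<comment> \<open>The elements of \<open>space P\<close> are extensional, so restriction to
      \<open>Basis\<close> is the identity on them and the joint law of the coordinates is
      \<open>P\<close> itself.\<close>
    have "distr P (Pi\<^sub>M Basis (\<lambda>_. borel)) (\<lambda>x. \<lambda>i\<in>Basis. x i) = distr P P (\<lambda>x. x)"
    proof (intro distr_cong)
      show "(\<lambda>i\<in>Basis. x i) = x" if "x \<in> space P" for x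
        using that by (auto simp: P_def space_PiM PiE_def extensional_restrict)
    qed (simp_all add: sP)
    also have "\<dots> = (\<Pi>\<^sub>M b\<in>Basis. distr P borel (\<lambda>f. f b))"
      by (simp add: coord P_def[symmetric] cong: PiM_cong)
    finally show "distr P (Pi\<^sub>M Basis (\<lambda>_. borel)) (\<lambda>x. \<lambda>i\<in>Basis. x i) = (\<Pi>\<^sub>M b\<in>Basis. distr P borel (\<lambda>f. f b))" .
  qed simp_all
  \<comment> \<open>\<open>sum_indep_normal\<close> demands positive deviations and a nonempty index
    set, so only the coordinates with nonzero coefficient are summed; \<open>a \<noteq> 0\<close>
    provides one.\<close>
  moreover define B where "B = {b\<in>Basis. a \<bullet> b \<noteq> 0}"
  ultimately have "indep_vars (\<lambda>_. borel) (\<lambda>b f. f b) B"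
    by (auto intro: indep_vars_subset)
  then have ind: "indep_vars (\<lambda>_. borel) (\<lambda>b f. 0 + (a \<bullet> b) * f b) B"
    by (rule indep_vars_compose2) simp
  have B: "finite B" "B \<noteq> {}"
    using False euclidean_all_zero_iff[of a] by (auto simp: B_def)
  have "distributed P lborel (\<lambda>f. \<Sum>b\<in>B. 0 + (a \<bullet> b) * f b)
      (normal_density (\<Sum>b\<in>B. 0 + (a \<bullet> b) * 0) (sqrt (\<Sum>b\<in>B. (\<bar>a \<bullet> b\<bar> * 1)\<^sup>2)))"
  proof (rule sum_indep_normal[OF B ind])
    fix b assume b: "b \<in> B"
    have "distr P lborel (\<lambda>f. f b) = distr P borel (\<lambda>f. f b)"
      by (intro distr_cong) simp_all
    then have "distributed P lborel (\<lambda>f. f b) (normal_density 0 1)"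
      using b coord[of b] by (simp add: distributed_def centered_normal_def B_def)
    then show "distributed P lborel (\<lambda>f. 0 + (a \<bullet> b) * f b) (normal_density (0 + (a \<bullet> b) * 0) (\<bar>a \<bullet> b\<bar> * 1))"
      using b by (intro normal_density_affine) (auto simp: B_def)
  qed (auto simp: B_def)
  moreover have sum_B: "(\<Sum>b\<in>B. g b) = (\<Sum>b\<in>Basis. g b)" if "\<And>b. a \<bullet> b = 0 \<Longrightarrow> g b = 0" for g :: "'a \<Rightarrow> real"
    using that by (intro sum.mono_neutral_left) (auto simp: B_def)
  ultimately have "distributed P lborel (\<lambda>f. \<Sum>b\<in>Basis. (a \<bullet> b) * f b) (normal_density 0 (sqrt (\<Sum>b\<in>Basis. (a \<bullet> b)\<^sup>2)))"
    by (simp add: sum_B)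
  then have d: "distr P lborel (\<lambda>f. \<Sum>b\<in>Basis. (a \<bullet> b) * f b) = density lborel (normal_density 0 (norm a))"
    by (simp add: distributed_def norm_eq_sqrt_inner[of a] euclidean_inner[of a a] power2_eq_square)
  have "distr std_gaussian borel (\<lambda>x. a \<bullet> x) = distr P borel (\<lambda>f. \<Sum>b\<in>Basis. (a \<bullet> b) * f b)"
    unfolding std_gaussian_def P_def[symmetric]
    by (simp add: distr_distr comp_def inner_sum_right mult.commute)
  also have "\<dots> = distr P lborel (\<lambda>f. \<Sum>b\<in>Basis. (a \<bullet> b) * f b)"
    by (intro distr_cong) simp_all
  finally show ?thesis
    using False by (simp add: d centered_normal_def)
qed

text \<open>The functional with coefficients \<open>t\<close> corresponds to the vector
  \<open>\<Sum>i\<in>I. t i *\<^sub>R u i\<close>, whose squared norm is the quadratic form of the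
  Gram matrix. Cramer-Wold gives the uniqueness needed to evaluate the definite description.\<close>

lemma centered_gaussian_gram:
  fixes u :: "'i \<Rightarrow> 'a::euclidean_space"
  assumes I: "finite I" and gram: "\<And>i j. i \<in> I \<Longrightarrow> j \<in> I \<Longrightarrow> u i \<bullet> u j = \<Sigma> i j"
  shows "centered_gaussian I \<Sigma> = distr std_gaussian (Pi\<^sub>M I (\<lambda>_. borel)) (\<lambda>x. \<lambda>i\<in>I. u i \<bullet> x)"
    (is "_ = ?D")
proof -
  have m[measurable]: "(\<lambda>x. \<lambda>i\<in>I. u i \<bullet> x) \<in> borel \<rightarrow>\<^sub>M Pi\<^sub>M I (\<lambda>_. borel)"
    by measurable
  have D: "is_centered_gaussian I \<Sigma> ?D"
    unfolding is_centered_gaussian_def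
  proof (intro conjI allI)
    show "prob_space ?D"
      by (intro prob_space.prob_space_distr prob_space_std_gaussian) simp
    fix t :: "'i \<Rightarrow> real"
    have gram': "u i \<bullet> u j = \<Sigma> j i" if "i \<in> I" "j \<in> I" for i j
      using gram[OF that(2,1)] by (simp add: inner_commute)
    have "(norm (\<Sum>i\<in>I. t i *\<^sub>R u i))\<^sup>2 = (\<Sum>i\<in>I. \<Sum>j\<in>I. t i * t j * \<Sigma> i j)"
      by (simp add: power2_norm_eq_inner inner_sum_left inner_sum_right gram' mult.assoc sum_distrib_left cong: sum.cong)
    moreover have "distr ?D borel (\<lambda>x. \<Sum>i\<in>I. t i * x i) = distr std_gaussian borel (\<lambda>x. (\<Sum>i\<in>I. t i *\<^sub>R u i) \<bullet> x)"
      by (simp add: distr_distr comp_def inner_sum_left)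
    ultimately show "distr ?D borel (\<lambda>x. \<Sum>i\<in>I. t i * x i) = centered_normal (\<Sum>i\<in>I. \<Sum>j\<in>I. t i * t j * \<Sigma> i j)"
      by (simp add: distr_std_gaussian)
  qed simp
  show ?thesis
    unfolding centered_gaussian_def
  proof (rule the_equality)
    show "M = ?D" if "is_centered_gaussian I \<Sigma> M" for M
      using that D by (intro cramer_wold_PiM[OF I]) (simp_all add: is_centered_gaussian_def)
  qed (rule D)
qed

text \<open>Testing the variational inequality for the closest point at its translates by
  \<open>a\<close> and by \<open>- a\<close> gives both inequalities. So the closest point map is
  the orthogonal projection.\<close>

lemma inner_closest_point_subspace:
  fixes V :: "'a::euclidean_space set"
  assumes "subspace V" "a \<in> V"
  shows "a \<bullet> closest_point V x = a \<bullet> x"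
proof -
  have V: "closed V" "convex V" "V \<noteq> {}"
    using assms by (auto intro: closed_subspace subspace_imp_convex)
  let ?c = "closest_point V x"
  have "?c \<in> V"
    using V by (simp add: closest_point_in_set)
  then have "?c + a \<in> V" "?c - a \<in> V"
    using assms by (auto intro: subspace_add subspace_diff)
  from closest_point_dot[OF V(2,1) this(1), of x] closest_point_dot[OF V(2,1) this(2), of x]
  show ?thesis
    by (simp add: inner_diff_left inner_diff_right inner_commute)
qed

lemma std_gaussian_on_subspace:
  fixes V :: "'a::euclidean_space set"
  assumes V: "subspace V"
  shows "std_gaussian_on V = distr std_gaussian borel (closest_point V)" (is "_ = ?D")
    and "closest_point V \<in> borel \<rightarrow>\<^sub>M borel"
proof -
  have V': "closed V" "convex V" "V \<noteq> {}"
    using V by (auto intro: closed_subspace subspace_imp_convex dest: subspace_0)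
  have [measurable]: "V \<in> sets borel"
    using V' by simp
  show m[measurable]: "closest_point V \<in> borel \<rightarrow>\<^sub>M borel"
    using V' by (intro borel_measurable_continuous_onI continuous_on_closest_point)
  have D: "is_std_gaussian_on V ?D"
    unfolding is_std_gaussian_on_def
  proof (intro conjI ballI)
    show "prob_space ?D"
      by (intro prob_space.prob_space_distr prob_space_std_gaussian) simp
    show "AE x in ?D. x \<in> V"
      using V' by (simp add: AE_distr_iff closest_point_in_set)
    show "distr ?D borel (\<lambda>x. a \<bullet> x) = centered_normal ((norm a)\<^sup>2)" if "a \<in> V" for a
      using that by (simp add: distr_distr comp_def inner_closest_point_subspace[OF V] distr_std_gaussian)
  qed simp
  \<comment> \<open>The definition prescribes functionals only for vectors of \<open>V\<close>,
    while Cramer-Wold needs all of them. Since \<open>M\<close> lives on \<open>V\<close>, any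
    \<open>a\<close> may be replaced by its projection.\<close>
  have proj: "distr M borel (\<lambda>x. a \<bullet> x) = centered_normal ((norm (closest_point V a))\<^sup>2)"
    if M: "is_std_gaussian_on V M" for M a
  proof -
    have [measurable_cong]: "sets M = sets borel"
      using M by (simp add: is_std_gaussian_on_def)
    have "closest_point V a \<bullet> x = a \<bullet> x" if "x \<in> V" for x
      using inner_closest_point_subspace[OF V that, of a] by (simp add: inner_commute)
    then have "distr M borel (\<lambda>x. a \<bullet> x) = distr M borel (\<lambda>x. closest_point V a \<bullet> x)"
      using M by (intro distr_cong_AE) (auto simp: is_std_gaussian_on_def)
    with M V' show ?thesis
      by (simp add: is_std_gaussian_on_def closest_point_in_set)
  qed
  show "std_gaussian_on V = ?D"
    unfolding std_gaussian_on_def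
  proof (rule the_equality)
    show "M = ?D" if "is_std_gaussian_on V M" for M
    proof (rule cramer_wold_euclidean)
      show "distr M borel (\<lambda>x. a \<bullet> x) = distr ?D borel (\<lambda>x. a \<bullet> x)" for a
        by (rule trans[OF proj[OF that] proj[OF D, symmetric]])
    qed (use that D in \<open>simp_all only: is_std_gaussian_on_def\<close>)
  qed (rule D)
qed

text \<open>Projection onto \<open>V\<close> preserves inner products with the \<open>u i\<close>,
  so the angle is the probability of a closed orthant event for the standard Gaussian on the whole
  space; its boundary is null, and \<open>centered_gaussian_gram\<close> identifies the open
  version. The point \<open>p\<close> ensures that the cone spans \<open>V\<close> and that no
  \<open>u i\<close> vanishes.\<close>

lemma solid_angle_eq_g_fun:
  fixes V :: "'a::euclidean_space set" and u :: "nat \<Rightarrow> 'a"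
  assumes V: "subspace V" and u: "\<And>i. i \<in> {1..m} \<Longrightarrow> u i \<in> V"
    and p: "p \<in> V" "\<And>i. i \<in> {1..m} \<Longrightarrow> u i \<bullet> p < 0"
    and gram: "\<And>i j. i \<in> {1..m} \<Longrightarrow> j \<in> {1..m} \<Longrightarrow> u i \<bullet> u j = orthocentric_gram l0 l i j"
  shows "solid_angle {v\<in>V. \<forall>i\<in>{1..m}. u i \<bullet> v \<le> 0} = g_fun m l0 l (\<lambda>_. 1)"
    (is "solid_angle ?C = _")
proof -
  interpret prob_space "std_gaussian :: 'a measure"
    by (rule prob_space_std_gaussian)
  have V': "closed V" "convex V" "V \<noteq> {}"
    using V by (auto intro: closed_subspace subspace_imp_convex dest: subspace_0)
  \<comment> \<open>\<open>p\<close> is an interior point of the cone relative to \<open>V\<close>.\<close>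
  have "V \<subseteq> span ?C"
  proof
    fix v assume v: "v \<in> V"
    \<comment> \<open>Large enough for \<open>v + r *\<^sub>R p\<close> to satisfy every inequality;
      the inserted 0 makes \<open>r\<close> nonnegative and covers \<open>m = 0\<close>. Then
      \<open>v\<close> is a difference of two points of the cone.\<close>
    define r where "r = Max (insert 0 ((\<lambda>i. (u i \<bullet> v) / - (u i \<bullet> p)) ` {1..m}))"
    have "(u i \<bullet> v) / - (u i \<bullet> p) \<le> r" if "i \<in> {1..m}" for i
      unfolding r_def using that by (intro Max_ge) auto
    then have "u i \<bullet> v \<le> r * - (u i \<bullet> p)" if "i \<in> {1..m}" for i
      using p(2)[OF that] that by (intro iffD1[OF pos_divide_le_eq]) auto
    then have *: "u i \<bullet> v + r * (u i \<bullet> p) \<le> 0" if "i \<in> {1..m}" for i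
      using that by force
    have "r \<ge> 0"
      unfolding r_def by (intro Max_ge) auto
    then have "r *\<^sub>R p \<in> ?C"
      using p V by (auto simp: subspace_scale mult_nonneg_nonpos less_imp_le)
    moreover have "v + r *\<^sub>R p \<in> ?C"
      using * v p V by (auto simp: subspace_add subspace_scale inner_add_right)
    ultimately have "(v + r *\<^sub>R p) - r *\<^sub>R p \<in> span ?C"
      by (intro span_diff span_base)
    then show "v \<in> span ?C"
      by simp
  qed
  then have span: "span ?C = V"
    using V by (intro equalityI span_minimal) auto
  have C: "?C = V \<inter> (\<Inter>i\<in>{1..m}. {v. u i \<bullet> v \<le> 0})"
    by auto
  have [measurable]: "?C \<in> sets borel"
    unfolding C using V' by (intro borel_closed closed_Int closed_INT ballI closed_halfspace_le) auto
  note [measurable] = std_gaussian_on_subspace(2)[OF V]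
  have "solid_angle ?C = prob {x. \<forall>i\<in>{1..m}. u i \<bullet> x \<le> 0}"
    unfolding solid_angle_def span std_gaussian_on_subspace(1)[OF V]
    by (subst measure_distr)
       (use V' in \<open>auto simp: inner_closest_point_subspace[OF V u] closest_point_in_set intro!: arg_cong[where f = prob]\<close>)
  also have "\<dots> = prob {x. \<forall>i\<in>{1..m}. u i \<bullet> x < 0}"
  proof (rule finite_measure_eq_AE)
    have "AE x in std_gaussian. u i \<bullet> x \<noteq> 0" if i: "i \<in> {1..m}" for i
    proof -
      have "norm (u i) > 0"
        using p(2)[OF i] by auto
      then have "measure (distr std_gaussian borel (\<lambda>x. u i \<bullet> x)) {0} = 0"
        by (simp add: distr_std_gaussian measure_centered_normal_0)
      then have "prob {x. u i \<bullet> x = 0} = 0"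
        by (subst (asm) measure_distr) (auto simp: vimage_def)
      then have "{x. u i \<bullet> x = 0} \<in> null_sets std_gaussian"
        by (intro null_setsI) (auto simp: emeasure_eq_measure)
      then show ?thesis
        by (rule AE_I') auto
    qed
    then have "AE x in std_gaussian. \<forall>i\<in>{1..m}. u i \<bullet> x \<noteq> 0"
      by (simp add: AE_finite_all)
    then show "AE x in std_gaussian. x \<in> {x. \<forall>i\<in>{1..m}. u i \<bullet> x \<le> 0} \<longleftrightarrow> x \<in> {x. \<forall>i\<in>{1..m}. u i \<bullet> x < 0}"
      by eventually_elim (auto simp: less_le)
  qed (simp_all, measurable)
  also have "\<dots> = g_fun m l0 l (\<lambda>_. 1)"
  \<comment> \<open>For \<open>m = 0\<close> the event is the whole space, in accordance with the
    value 1 fixed in \<open>g_fun\<close>.\<close>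
  proof (cases "m = 0")
    case True
    then show ?thesis
      using prob_space by (simp add: g_fun_def)
  next
    case False
    have cg: "centered_gaussian {1..m} (orthocentric_gram l0 l) =
        distr std_gaussian (Pi\<^sub>M {1..m} (\<lambda>_. borel)) (\<lambda>x. \<lambda>i\<in>{1..m}. u i \<bullet> x)"
      by (rule centered_gaussian_gram) (simp_all only: gram finite_atLeastAtMost)
    have sp: "space (centered_gaussian {1..m} (orthocentric_gram l0 l)) = Pi\<^sub>E {1..m} (\<lambda>_. UNIV)"
      unfolding cg by (simp add: space_PiM)
    have "measure (centered_gaussian {1..m} (orthocentric_gram l0 l)) {x\<in>Pi\<^sub>E {1..m} (\<lambda>_. UNIV). \<forall>i\<in>{1..m}. x i < 0} =
        prob {x. \<forall>i\<in>{1..m}. u i \<bullet> x < 0}"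
      unfolding cg
    proof (subst measure_distr)
      have "{x\<in>space (Pi\<^sub>M {1..m} (\<lambda>_. borel :: real measure)). \<forall>i\<in>{1..m}. x i < 0} \<in> sets (Pi\<^sub>M {1..m} (\<lambda>_. borel))"
        by measurable
      then show "{x\<in>Pi\<^sub>E {1..m} (\<lambda>_. UNIV). \<forall>i\<in>{1..m}. x i < 0} \<in> sets (Pi\<^sub>M {1..m} (\<lambda>_. borel :: real measure))"
        by (simp add: space_PiM)
    qed (auto intro!: arg_cong[where f = prob])
    with False show ?thesis
      by (simp add: g_fun_def Let_def sp del: One_nat_def)
  qed
  finally show ?thesis .
qed

section \<open>Cones of an orthogonal simplex at a face\<close>

lemma convex_cone_hull_image:
  fixes u :: "'i \<Rightarrow> 'a::real_vector"
  assumes J: "finite J"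
  shows "convex_cone hull (u ` J) = {\<Sum>j\<in>J. c j *\<^sub>R u j |c. \<forall>j\<in>J. 0 \<le> c j}" (is "_ = ?R")
proof
  have "0 \<in> ?R"
    by (auto intro!: exI[of _ "\<lambda>_. 0"])
  moreover have "x + y \<in> ?R" if "x \<in> ?R" "y \<in> ?R" for x y
  proof -
    obtain b c where "x = (\<Sum>j\<in>J. b j *\<^sub>R u j)" "y = (\<Sum>j\<in>J. c j *\<^sub>R u j)" "\<forall>j\<in>J. 0 \<le> b j" "\<forall>j\<in>J. 0 \<le> c j"
      using \<open>x \<in> ?R\<close> \<open>y \<in> ?R\<close> by blast
    then show ?thesis
      by (auto intro!: exI[of _ "\<lambda>j. b j + c j"] simp: sum.distrib scaleR_left_distrib)
  qed
  moreover have "t *\<^sub>R x \<in> ?R" if "x \<in> ?R" "0 \<le> t" for x t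
  proof -
    obtain c where "x = (\<Sum>j\<in>J. c j *\<^sub>R u j)" "\<forall>j\<in>J. 0 \<le> c j"
      using \<open>x \<in> ?R\<close> by blast
    with \<open>0 \<le> t\<close> show ?thesis
      by (auto intro!: exI[of _ "\<lambda>j. t * c j"] simp: scaleR_sum_right)
  qed
  ultimately have "convex_cone ?R"
    unfolding convex_cone_iff by blast
  moreover have "u j \<in> ?R" if "j \<in> J" for j
    using J that by (intro CollectI exI[of _ "\<lambda>i. of_bool (i = j)"]) (simp add: of_bool_def if_distrib[of "\<lambda>t. t *\<^sub>R _"] cong: if_cong)
  ultimately show "convex_cone hull (u ` J) \<subseteq> ?R"
    by (intro hull_minimal) auto
next
  have "(\<Sum>j\<in>K. c j *\<^sub>R u j) \<in> convex_cone hull (u ` J)" if "\<forall>j\<in>J. 0 \<le> c j" "K \<subseteq> J" for c K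
    using finite_subset[OF that(2) J] that
  proof (induction K rule: finite_induct)
    case (insert j K)
    then have "c j *\<^sub>R u j \<in> convex_cone hull (u ` J)"
      by (intro convex_cone_hull_mul hull_inc) auto
    with insert show ?case
      by (simp add: convex_cone_hull_add)
  qed (simp add: convex_cone_hull_contains_0)
  then show "?R \<subseteq> convex_cone hull (u ` J)"
    by blast
qed

text \<open>Pairing a linear relation among the \<open>u i\<close> with \<open>f j\<close> isolates
  the coefficient of \<open>u j\<close>. The lemma serves \<open>tgen\<close> against
  \<open>ngen\<close> in both directions, and the orthogonal family \<open>vtx\<close> against
  itself.\<close>

lemma biorthogonal_independent:
  fixes u f :: "'i \<Rightarrow> 'a::euclidean_space"
  assumes J: "finite J" and uf: "\<And>i j. i \<in> J \<Longrightarrow> j \<in> J \<Longrightarrow> u i \<bullet> f j = 0 \<longleftrightarrow> i \<noteq> j"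
  shows "inj_on u J" and "independent (u ` J)"
proof -
  show inj: "inj_on u J"
    using uf by (intro inj_onI) metis
  show "independent (u ` J)"
  proof (rule independent_if_scalars_zero)
    fix c x assume 0: "(\<Sum>x\<in>u ` J. c x *\<^sub>R x) = 0" and "x \<in> u ` J"
    then obtain j where j: "j \<in> J" "x = u j"
      by auto
    have "0 = (\<Sum>x\<in>u ` J. c x *\<^sub>R x) \<bullet> f j"
      by (simp add: 0)
    also have "\<dots> = (\<Sum>i\<in>J. c (u i) * (u i \<bullet> f j))"
      by (simp add: sum.reindex[OF inj] inner_sum_left)
    also have "\<dots> = (\<Sum>i\<in>{j}. c (u i) * (u i \<bullet> f j))"
      using J j uf by (intro sum.mono_neutral_right) auto
    finally show "c x = 0"
      using j uf[of j j] by simp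
  qed (use J in simp)
qed

lemma isometric_cones_refl: "isometric_cones C C"
  unfolding isometric_cones_def by (intro exI[of _ "\<lambda>x. x"]) (simp add: linear_id[unfolded id_def])

lemma lineality_space_eq:
  assumes "subspace L" "affine_parallel (affine hull F) L"
  shows "lineality_space F = L"
  unfolding lineality_space_def
proof (rule the_equality)
  show "M = L" if "subspace M \<and> affine_parallel (affine hull F) M" for M
    using assms that parallel_subspace affine_parallel_assoc affine_parallel_commute by metis
qed (use assms in blast)

lemma sum_shift_gt: "k \<le> d \<Longrightarrow> (\<Sum>i\<in>{1..d - k}. f (k + i)) = (\<Sum>j\<in>{k<..d}. f j)" for k d :: nat
  by (rule sum.reindex_bij_witness[of _ "\<lambda>j. j - k" "\<lambda>i. k + i"]) auto

lemma image_shift_gt: "k \<le> d \<Longrightarrow> (+) k ` {1..d - k} = {k<..d}" for k d :: nat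
  by (auto simp: image_iff intro!: bexI[of _ "_ - k"])

section \<open>The simplex, its face and the generators of its cones\<close>

locale orthogonal_simplex =
  fixes d k :: nat and \<tau> :: "nat \<Rightarrow> real" and e :: "nat \<Rightarrow> 'a::euclidean_space"
  assumes \<tau>_pos: "\<And>i. i \<le> d \<Longrightarrow> \<tau> i > 0" and e: "bij_betw e {0..d} Basis" and k: "k \<le> d"
begin

definition vtx :: "nat \<Rightarrow> 'a" where "vtx i = (1 / \<tau> i) *\<^sub>R e i"
definition S :: "'a set" where "S = convex hull (vtx ` {0..d})"
definition F :: "'a set" where "F = convex hull (vtx ` {0..k})"
definition s :: real where "s = (\<Sum>i=0..k. (\<tau> i)\<^sup>2)"
definition \<sigma> :: real where "\<sigma> = (\<Sum>i=0..d. (\<tau> i)\<^sup>2)"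
text \<open>A normal vector of the affine hull of \<open>S\<close>, which is the hyperplane
  \<open>w \<bullet> x = 1\<close>.\<close>

definition w :: 'a where "w = (\<Sum>i=0..d. \<tau> i *\<^sub>R e i)"
text \<open>The convex combination of the vertices of \<open>F\<close> with weights
  \<open>(\<tau> i)\<^sup>2 / s\<close>. It is also the foot of the perpendicular from the origin to
  the affine hull of \<open>F\<close>, hence orthogonal to \<open>L\<close>.\<close>

definition x0 :: 'a where "x0 = (1 / s) *\<^sub>R (\<Sum>i=0..k. \<tau> i *\<^sub>R e i)"
definition tgen :: "nat \<Rightarrow> 'a" where "tgen j = vtx j - x0"
text \<open>The orthogonal projection of \<open>- vtx j\<close> to the hyperplane
  \<open>w \<bullet> x = 0\<close>: an outer normal, within the affine hull of \<open>S\<close>, of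
  the facet opposite to \<open>vtx j\<close>.\<close>

definition ngen :: "nat \<Rightarrow> 'a" where "ngen j = (1 / \<sigma>) *\<^sub>R w - vtx j"
definition L :: "'a set" where "L = {v. w \<bullet> v = 0 \<and> (\<forall>j\<in>{k<..d}. e j \<bullet> v = 0)}"

lemma e_Basis: "i \<le> d \<Longrightarrow> e i \<in> Basis"
  using e by (auto simp: bij_betw_def)

lemma e_inner: "i \<le> d \<Longrightarrow> j \<le> d \<Longrightarrow> e i \<bullet> e j = of_bool (i = j)"
  using e by (auto simp: inner_Basis e_Basis bij_betw_def inj_on_def)

lemma coordinate_eqI: "(\<And>i. i \<le> d \<Longrightarrow> e i \<bullet> x = e i \<bullet> y) \<Longrightarrow> x = y"
proof (rule euclidean_eqI)
  fix b :: 'a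
  assume eq: "\<And>i. i \<le> d \<Longrightarrow> e i \<bullet> x = e i \<bullet> y" and "b \<in> Basis"
  then obtain i where "i \<le> d" "b = e i"
    using e by (force simp: bij_betw_def)
  with eq show "x \<bullet> b = y \<bullet> b"
    by (simp add: inner_commute)
qed

lemma s_pos: "s > 0" and \<sigma>_pos: "\<sigma> > 0"
  using \<tau>_pos k unfolding s_def \<sigma>_def by (auto intro!: sum_pos zero_less_power)

lemma \<sigma>_eq: "\<sigma> = s + (\<Sum>j\<in>{k<..d}. (\<tau> j)\<^sup>2)"
proof -
  have "{0..d} = {0..k} \<union> {k<..d}"
    using k by auto
  then show ?thesis
    unfolding \<sigma>_def s_def by (simp only:) (rule sum.union_disjoint; auto)
qed

lemma e_w: "i \<le> d \<Longrightarrow> e i \<bullet> w = \<tau> i"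
  by (simp add: w_def inner_sum_right e_inner of_bool_def if_distrib cong: if_cong)

lemma e_x0: "i \<le> d \<Longrightarrow> e i \<bullet> x0 = (if i \<le> k then \<tau> i / s else 0)"
  using k by (simp add: x0_def inner_sum_right e_inner of_bool_def if_distrib cong: if_cong)

lemma e_vtx: "i \<le> d \<Longrightarrow> j \<le> d \<Longrightarrow> e i \<bullet> vtx j = (if i = j then 1 / \<tau> i else 0)"
  by (simp add: vtx_def e_inner)

lemma w_inner: "w \<bullet> x = (\<Sum>i=0..d. \<tau> i * (e i \<bullet> x))"
  by (simp add: w_def inner_sum_left)

lemma w_inner_k: "(\<And>j. j \<in> {k<..d} \<Longrightarrow> e j \<bullet> x = 0) \<Longrightarrow> w \<bullet> x = (\<Sum>i=0..k. \<tau> i * (e i \<bullet> x))"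
  unfolding w_inner using k by (intro sum.mono_neutral_right) auto

lemma x0_inner: "x0 \<bullet> x = (\<Sum>i=0..k. \<tau> i * (e i \<bullet> x)) / s"
  by (simp add: x0_def inner_sum_left)

lemma w_w: "w \<bullet> w = \<sigma>"
  by (simp add: w_inner[of w] e_w \<sigma>_def power2_eq_square)

lemma w_vtx: "i \<le> d \<Longrightarrow> w \<bullet> vtx i = 1"
  using \<tau>_pos[of i] by (simp add: vtx_def inner_commute[of w] e_w)

lemma x0_vtx: "i \<le> d \<Longrightarrow> x0 \<bullet> vtx i = (if i \<le> k then 1 / s else 0)"
  using \<tau>_pos[of i] by (simp add: vtx_def inner_commute[of x0] e_x0)

lemma vtx_vtx: "i \<le> d \<Longrightarrow> j \<le> d \<Longrightarrow> vtx i \<bullet> vtx j = (if i = j then 1 / (\<tau> i)\<^sup>2 else 0)"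
  by (simp add: vtx_def e_inner power2_eq_square)

lemma x0_x0: "x0 \<bullet> x0 = 1 / s"
  using s_pos k by (simp add: x0_inner[of x0] e_x0 sum_divide_distrib[symmetric] s_def[symmetric] power2_eq_square[symmetric])

lemma w_x0: "w \<bullet> x0 = 1"
proof -
  have "w \<bullet> x0 = (\<Sum>i=0..k. \<tau> i * (e i \<bullet> x0))"
    by (rule w_inner_k) (simp add: e_x0)
  also have "\<dots> = 1"
    using s_pos k by (simp add: e_x0 sum_divide_distrib[symmetric] s_def[symmetric] power2_eq_square[symmetric])
  finally show ?thesis .
qed

lemmas inner_table = w_w w_vtx x0_vtx vtx_vtx x0_x0 w_x0
  w_x0[unfolded inner_commute[of w]] w_vtx[unfolded inner_commute[of w]] x0_vtx[unfolded inner_commute[of x0]]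

lemma w_tgen: "j \<in> {k<..d} \<Longrightarrow> w \<bullet> tgen j = 0" and w_ngen: "j \<in> {k<..d} \<Longrightarrow> w \<bullet> ngen j = 0"
  using \<sigma>_pos by (simp_all add: tgen_def ngen_def inner_diff_right inner_table)

lemma tgen_tgen: "i \<in> {k<..d} \<Longrightarrow> j \<in> {k<..d} \<Longrightarrow> tgen i \<bullet> tgen j = 1 / s + (if i = j then 1 / (\<tau> i)\<^sup>2 else 0)"
  by (simp add: tgen_def inner_diff_right inner_diff_left inner_table)

lemma ngen_ngen: "i \<in> {k<..d} \<Longrightarrow> j \<in> {k<..d} \<Longrightarrow> ngen i \<bullet> ngen j = 1 / (- \<sigma>) + (if i = j then 1 / (\<tau> i)\<^sup>2 else 0)"
  using \<sigma>_pos by (simp add: ngen_def inner_diff_right inner_diff_left inner_table)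

lemma tgen_ngen: "i \<in> {k<..d} \<Longrightarrow> j \<in> {k<..d} \<Longrightarrow> tgen i \<bullet> ngen j = (if i = j then - (1 / (\<tau> i)\<^sup>2) else 0)"
  using \<sigma>_pos by (simp add: tgen_def ngen_def inner_diff_right inner_diff_left inner_table)

lemma gens_independent:
  "inj_on tgen {k<..d}" "independent (tgen ` {k<..d})"
  "inj_on ngen {k<..d}" "independent (ngen ` {k<..d})"
proof -
  have "tgen i \<bullet> ngen j = 0 \<longleftrightarrow> i \<noteq> j" "ngen i \<bullet> tgen j = 0 \<longleftrightarrow> i \<noteq> j"
    if "i \<in> {k<..d}" "j \<in> {k<..d}" for i j
    using that \<tau>_pos[of i] \<tau>_pos[of j] by (auto simp: tgen_ngen inner_commute[of "ngen i"])
  then show "inj_on tgen {k<..d}" "independent (tgen ` {k<..d})"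
    "inj_on ngen {k<..d}" "independent (ngen ` {k<..d})"
    using biorthogonal_independent[of "{k<..d}" tgen ngen] biorthogonal_independent[of "{k<..d}" ngen tgen]
    by auto
qed

text \<open>The parameters of the first cone are all positive. Those of the second have the single
  negative entry \<open>- \<sigma>\<close> and total \<open>- s < 0\<close>, which is condition (B).
  The shift by \<open>k\<close> renumbers the vertices outside \<open>F\<close> as
  \<open>1, ..., d - k\<close>.\<close>

lemma orthocentric_cone_gens:
  assumes "k < d"
  shows "orthocentric_cone (d - k) s (\<lambda>i. (\<tau> (k + i))\<^sup>2) (\<lambda>_. 1) (convex_cone hull (tgen ` {k<..d}))"
    and "orthocentric_cone (d - k) (- \<sigma>) (\<lambda>i. (\<tau> (k + i))\<^sup>2) (\<lambda>_. 1) (convex_cone hull (ngen ` {k<..d}))"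
proof -
  have im: "(\<lambda>i. (1::real) *\<^sub>R g (k + i)) ` {1..d - k} = g ` {k<..d}" "(\<lambda>i. g (k + i)) ` {1..d - k} = g ` {k<..d}"
    for g :: "nat \<Rightarrow> 'a"
    using image_image[of g "(+) k" "{1..d - k}"] unfolding image_shift_gt[OF k] by simp_all
  have inj: "inj_on (\<lambda>i. g (k + i)) {1..d - k}" if "inj_on g {k<..d}" for g :: "nat \<Rightarrow> 'a"
    using comp_inj_on[of "(+) k" "{1..d - k}" g] that image_shift_gt[OF k] by (simp add: comp_def)
  have tpos: "0 < (\<tau> (k + i))\<^sup>2" if "i \<in> {1..d - k}" for i
    using that k by (intro zero_less_power \<tau>_pos) auto
  have "condition_A (d - k) ((\<lambda>i. (\<tau> (k + i))\<^sup>2)(0 := s))"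
    using tpos s_pos by (auto simp: condition_A_def)
  then show "orthocentric_cone (d - k) s (\<lambda>i. (\<tau> (k + i))\<^sup>2) (\<lambda>_. 1) (convex_cone hull (tgen ` {k<..d}))"
    unfolding orthocentric_cone_def using assms
    by (intro conjI exI[of _ "\<lambda>i. tgen (k + i)"] ballI inj gens_independent)
      (auto simp: im gens_independent orthocentric_gram_def tgen_tgen simp del: One_nat_def)
  have "(\<Sum>i=0..d - k. ((\<lambda>i. (\<tau> (k + i))\<^sup>2)(0 := - \<sigma>)) i) = - \<sigma> + (\<Sum>i\<in>{1..d - k}. (\<tau> (k + i))\<^sup>2)"
    by (simp add: sum.atLeast_Suc_atMost)
  also have "\<dots> = - s"
    using sum_shift_gt[OF k, of "\<lambda>i. (\<tau> i)\<^sup>2"] \<sigma>_eq by simp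
  finally have "condition_B (d - k) ((\<lambda>i. (\<tau> (k + i))\<^sup>2)(0 := - \<sigma>))"
    using tpos s_pos \<sigma>_pos unfolding condition_B_def by (auto intro!: bexI[of _ 0])
  then show "orthocentric_cone (d - k) (- \<sigma>) (\<lambda>i. (\<tau> (k + i))\<^sup>2) (\<lambda>_. 1) (convex_cone hull (ngen ` {k<..d}))"
    unfolding orthocentric_cone_def using assms
    by (intro conjI exI[of _ "\<lambda>i. ngen (k + i)"] ballI inj gens_independent)
      (auto simp: im gens_independent orthocentric_gram_def ngen_ngen simp del: One_nat_def)
qed

section \<open>Affine geometry of the simplex and its face\<close>

lemma vtx_independent: "inj_on vtx {0..d}" "independent (vtx ` {0..d})"
proof -
  have "vtx i \<bullet> vtx j = 0 \<longleftrightarrow> i \<noteq> j" if "i \<in> {0..d}" "j \<in> {0..d}" for i j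
    using that \<tau>_pos[of i] by (auto simp: vtx_vtx)
  then show "inj_on vtx {0..d}" "independent (vtx ` {0..d})"
    using biorthogonal_independent[of "{0..d}" vtx vtx] by simp_all
qed

text \<open>The coefficients add up to \<open>w \<bullet> x\<close>, so on the hyperplane
  \<open>w \<bullet> x = 1\<close> they are barycentric coordinates. This yields \<open>S_eq\<close>
  and \<open>affine_hull_vtx\<close>.\<close>

lemma vtx_expansion:
  assumes "J \<subseteq> {0..d}" "\<And>i. i \<in> {0..d} - J \<Longrightarrow> e i \<bullet> x = 0"
  shows "x = (\<Sum>i\<in>J. (\<tau> i * (e i \<bullet> x)) *\<^sub>R vtx i)" and "w \<bullet> x = (\<Sum>i\<in>J. \<tau> i * (e i \<bullet> x))"
proof -
  have J: "finite J"
    using assms(1) finite_subset by blast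
  show "x = (\<Sum>i\<in>J. (\<tau> i * (e i \<bullet> x)) *\<^sub>R vtx i)"
  proof (rule coordinate_eqI)
    fix i assume i: "i \<le> d"
    have "(\<Sum>j\<in>J. \<tau> j * (e j \<bullet> x) * (e i \<bullet> vtx j)) = (\<Sum>j\<in>J. if i = j then e i \<bullet> x else 0)"
    proof (rule sum.cong[OF refl])
      fix j assume "j \<in> J"
      then have "j \<le> d"
        using assms(1) by auto
      then show "\<tau> j * (e j \<bullet> x) * (e i \<bullet> vtx j) = (if i = j then e i \<bullet> x else 0)"
        using i \<tau>_pos[of j] by (simp add: e_vtx)
    qed
    then show "e i \<bullet> x = e i \<bullet> (\<Sum>i\<in>J. (\<tau> i * (e i \<bullet> x)) *\<^sub>R vtx i)"
      using i J assms(2)[of i] by (auto simp: inner_sum_right)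
  qed
  show "w \<bullet> x = (\<Sum>i\<in>J. \<tau> i * (e i \<bullet> x))"
    unfolding w_inner using assms by (intro sum.mono_neutral_right) auto
qed

lemma S_eq: "S = {x. w \<bullet> x = 1 \<and> (\<forall>i\<in>{0..d}. 0 \<le> e i \<bullet> x)}" (is "_ = ?R")
proof
  have "?R = {x. w \<bullet> x = 1} \<inter> (\<Inter>i\<in>{0..d}. {x. 0 \<le> e i \<bullet> x})"
    by auto
  also have "convex \<dots>"
    by (intro convex_Int convex_INT convex_hyperplane convex_halfspace_ge)
  finally show "S \<subseteq> ?R"
    unfolding S_def using \<tau>_pos by (intro hull_minimal) (auto simp: w_vtx e_vtx less_imp_le)
  show "?R \<subseteq> S"
  proof
    fix x assume x: "x \<in> ?R"
    have "(\<Sum>i\<in>{0..d}. (\<tau> i * (e i \<bullet> x)) *\<^sub>R vtx i) \<in> S"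
      using x vtx_expansion(2)[of "{0..d}" x] \<tau>_pos unfolding S_def
      by (intro convex_sum) (auto intro!: hull_inc mult_nonneg_nonneg simp: less_imp_le)
    then show "x \<in> S"
      using vtx_expansion(1)[of "{0..d}" x, symmetric] by simp
  qed
qed

lemma affine_hull_vtx: "affine hull (vtx ` {0..k}) = {x. w \<bullet> x = 1 \<and> (\<forall>j\<in>{k<..d}. e j \<bullet> x = 0)}" (is "_ = ?R")
proof
  have "affine ?R"
    by (auto simp: affine_def inner_add_right)
  then show "affine hull (vtx ` {0..k}) \<subseteq> ?R"
    using k by (intro hull_minimal) (auto simp: w_vtx e_vtx)
  show "?R \<subseteq> affine hull (vtx ` {0..k})"
  proof
    fix x assume x: "x \<in> ?R"
    have inj: "inj_on vtx {0..k}"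
      using vtx_independent(1) k by (auto intro: inj_on_subset)
    \<comment> \<open>\<open>affine_hull_finite\<close> takes coefficients that are functions of the
      points, not of the indices; the Fourier coefficient recovers the barycentric one from the
      vertex alone.\<close>
    have c: "(x \<bullet> vtx i) / (vtx i \<bullet> vtx i) = \<tau> i * (e i \<bullet> x)" if "i \<le> d" for i
      using \<tau>_pos[OF that] that by (simp add: vtx_vtx) (simp add: vtx_def inner_commute power2_eq_square)
    have "sum (\<lambda>y. (x \<bullet> y) / (y \<bullet> y)) (vtx ` {0..k}) = 1" "(\<Sum>y\<in>vtx ` {0..k}. ((x \<bullet> y) / (y \<bullet> y)) *\<^sub>R y) = x"
      using x k vtx_expansion(1)[of "{0..k}" x, symmetric] vtx_expansion(2)[of "{0..k}" x] by (simp_all add: sum.reindex[OF inj] c)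
    then show "x \<in> affine hull (vtx ` {0..k})"
      by (subst affine_hull_finite) (auto intro!: exI[of _ "\<lambda>y. (x \<bullet> y) / (y \<bullet> y)"])
  qed
qed

lemma subspace_L: "subspace L"
  by (auto simp: L_def subspace_def inner_add_right)

lemma affine_parallel_F: "affine_parallel (affine hull F) L"
proof -
  have "affine_parallel L (affine hull F)"
    unfolding affine_parallel_expl F_def affine_hull_convex_hull affine_hull_vtx L_def
    using w_x0 by (intro exI[of _ x0]) (auto simp: inner_add_right e_x0)
  then show "affine_parallel (affine hull F) L"
    by (rule affine_parallel_commute)
qed

lemma lineality_space_F: "lineality_space F = L"
  by (rule lineality_space_eq[OF subspace_L affine_parallel_F])

lemma F_face: "F face_of S" and aff_dim_F: "aff_dim F = int k"
proof -
  have aff: "\<not> affine_dependent (vtx ` J)" if "J \<subseteq> {0..d}" for J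
    using vtx_independent(2) that independent_mono[of "vtx ` {0..d}" "vtx ` J"] affine_dependent_imp_dependent by blast
  show "F face_of S"
    unfolding S_def F_def using k by (subst face_of_convex_hull_affine_independent) (auto intro!: aff exI[of _ "vtx ` {0..k}"])
  have "card (vtx ` {0..k}) = k + 1"
    using vtx_independent(1) k by (subst card_image) (auto intro: inj_on_subset)
  then show "aff_dim F = int k"
    unfolding F_def aff_dim_convex_hull using aff_dim_affine_independent[OF aff[of "{0..k}"]] k by simp
qed

lemma dim_L: "dim L = k"
  using aff_dim_parallel_subspace[OF _ subspace_L affine_parallel_F] aff_dim_F by (simp add: F_def)

lemma x0_rel_interior: "x0 \<in> rel_interior F"
proof -
  have inj: "inj_on vtx {0..k}"
    using vtx_independent(1) k by (auto intro: inj_on_subset)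
  \<comment> \<open>The weight \<open>(\<tau> i)\<^sup>2 / s\<close> as a function of the vertex,
    whose squared norm is \<open>1 / (\<tau> i)\<^sup>2\<close>. Positive weights on all vertices of
    \<open>F\<close> place \<open>x0\<close> in the relative interior.\<close>
  define u where "u y = 1 / (s * (y \<bullet> y))" for y :: 'a
  have u: "u (vtx i) = (\<tau> i)\<^sup>2 / s" if "i \<in> {0..k}" for i
    using that k by (simp add: u_def vtx_vtx)
  have "x0 = (\<Sum>i=0..k. u (vtx i) *\<^sub>R vtx i)"
    unfolding x0_def scaleR_sum_right
  proof (rule sum.cong[OF refl])
    show "(1 / s) *\<^sub>R \<tau> i *\<^sub>R e i = u (vtx i) *\<^sub>R vtx i" if "i \<in> {0..k}" for i
      using u[OF that] by (simp add: vtx_def power2_eq_square)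
  qed
  then have "(\<Sum>y\<in>vtx ` {0..k}. u y *\<^sub>R y) = x0"
    by (simp add: sum.reindex[OF inj])
  moreover have "sum u (vtx ` {0..k}) = 1"
    using s_pos by (simp add: sum.reindex[OF inj] u sum_divide_distrib[symmetric] s_def[symmetric])
  moreover have "\<forall>y\<in>vtx ` {0..k}. 0 < u y"
    using k s_pos by (auto simp: u intro!: divide_pos_pos zero_less_power \<tau>_pos)
  ultimately show ?thesis
    unfolding F_def using explicit_subset_rel_interior_convex_hull_minimal[of "vtx ` {0..k}"] by blast
qed

section \<open>Tangent and normal cones by linear conditions\<close>

lemma convex_S: "convex S" and convex_F: "convex F" and F_subset_S: "F \<subseteq> S"
  using k by (auto simp: S_def F_def intro!: hull_mono convex_convex_hull)

text \<open>Among the inequalities describing \<open>S\<close>, those with index at most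
  \<open>k\<close> are strict at \<open>x0\<close> and do not restrict small moves; the others are
  active and survive.\<close>

lemma tangent_cone_F: "tangent_cone F S = {v. w \<bullet> v = 0 \<and> (\<forall>j\<in>{k<..d}. 0 \<le> e j \<bullet> v)}" (is "_ = ?R")
proof -
  have "(\<exists>\<epsilon>>0. x0 + \<epsilon> *\<^sub>R v \<in> S) \<longleftrightarrow> v \<in> ?R" for v
  proof
    assume "\<exists>\<epsilon>>0. x0 + \<epsilon> *\<^sub>R v \<in> S"
    then obtain \<epsilon> where \<epsilon>: "\<epsilon> > 0" "x0 + \<epsilon> *\<^sub>R v \<in> S"
      by blast
    then have "0 \<le> e j \<bullet> v" if "j \<in> {k<..d}" for j
      using that by (auto simp: S_eq inner_add_right e_x0 zero_le_mult_iff dest: bspec[of _ _ j])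
    with \<epsilon> show "v \<in> ?R"
      by (simp add: S_eq inner_add_right w_x0)
  next
    assume v: "v \<in> ?R"
    \<comment> \<open>The least positive coordinate of \<open>x0\<close>. A move of length below
      \<open>m\<close> keeps the coordinates up to \<open>k\<close> nonnegative; the 1 in the
      denominator of \<epsilon> guards against \<open>v = 0\<close>.\<close>
    define m where "m = Min ((\<lambda>i. \<tau> i / s) ` {0..k})"
    have m: "m > 0"
      using \<tau>_pos k s_pos by (simp add: m_def)
    have mi: "m \<le> \<tau> i / s" if "i \<le> k" for i
      unfolding m_def using that by (intro Min_le) auto
    define \<epsilon> where "\<epsilon> = m / (norm v + 1)"
    have "\<epsilon> > 0"
      using m by (simp add: \<epsilon>_def add_nonneg_pos)
    have "0 \<le> e i \<bullet> x0 + \<epsilon> * (e i \<bullet> v)" if i: "i \<le> d" for i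
    proof (cases "i \<le> k")
      case True
      have "\<bar>e i \<bullet> v\<bar> \<le> norm v"
        using Cauchy_Schwarz_ineq2[of "e i" v] norm_Basis[OF e_Basis[OF i]] by simp
      then have "\<epsilon> * \<bar>e i \<bullet> v\<bar> \<le> \<epsilon> * (norm v + 1)"
        using \<open>\<epsilon> > 0\<close> by (intro mult_left_mono) auto
      also have "\<dots> = m"
        unfolding \<epsilon>_def by (simp add: add_nonneg_eq_0_iff)
      finally have "\<bar>\<epsilon> * (e i \<bullet> v)\<bar> \<le> \<tau> i / s"
        using mi[OF True] \<open>\<epsilon> > 0\<close> by (simp add: abs_mult)
      then show ?thesis
        using True i by (simp add: e_x0 abs_le_iff)
    next
      case False
      then show ?thesis
        using v i \<open>\<epsilon> > 0\<close> by (simp add: e_x0)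
    qed
    then have "x0 + \<epsilon> *\<^sub>R v \<in> S"
      using v by (simp add: S_eq inner_add_right w_x0)
    with \<open>\<epsilon> > 0\<close> show "\<exists>\<epsilon>>0. x0 + \<epsilon> *\<^sub>R v \<in> S"
      by blast
  qed
  then show ?thesis
    unfolding tangent_cone_eq[OF convex_S convex_F F_subset_S x0_rel_interior] by blast
qed

text \<open>A functional attaining its maximum over \<open>S\<close> at \<open>x0\<close> is at most
  \<open>x0 \<bullet> v\<close> on the vertices of \<open>F\<close>, yet its weighted mean over
  them, with positive weights, equals \<open>x0 \<bullet> v\<close>. So it is constant on
  them.\<close>

lemma normal_cone_F:
  "normal_cone F S = {v. (\<forall>i\<in>{0..k}. vtx i \<bullet> v = x0 \<bullet> v) \<and> (\<forall>j\<in>{k<..d}. vtx j \<bullet> v \<le> x0 \<bullet> v)}" (is "_ = ?R")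
proof -
  have "(\<forall>z\<in>S. v \<bullet> (z - x0) \<le> 0) \<longleftrightarrow> v \<in> ?R" for v
  proof
    assume "\<forall>z\<in>S. v \<bullet> (z - x0) \<le> 0"
    moreover have "vtx i \<in> S" if "i \<in> {0..d}" for i
      unfolding S_def using that by (intro hull_inc imageI)
    ultimately have "v \<bullet> (vtx i - x0) \<le> 0" if "i \<in> {0..d}" for i
      using that by blast
    then have le: "vtx i \<bullet> v \<le> x0 \<bullet> v" if "i \<in> {0..d}" for i
      using that by (simp add: inner_diff_right inner_commute)
    have x0v: "s * (x0 \<bullet> v) = (\<Sum>i=0..k. (\<tau> i)\<^sup>2 * (vtx i \<bullet> v))"
    proof -
      have "(\<tau> i)\<^sup>2 * (vtx i \<bullet> v) = \<tau> i * (e i \<bullet> v)" if "i \<in> {0..k}" for i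
        using \<tau>_pos[of i] that k by (simp add: vtx_def power2_eq_square)
      then have "(\<Sum>i=0..k. (\<tau> i)\<^sup>2 * (vtx i \<bullet> v)) = (\<Sum>i=0..k. \<tau> i * (e i \<bullet> v))"
        by (intro sum.cong) auto
      then show ?thesis
        using s_pos by (simp add: x0_inner[of v])
    qed
    have "(\<Sum>i=0..k. (\<tau> i)\<^sup>2 * (x0 \<bullet> v - vtx i \<bullet> v)) = s * (x0 \<bullet> v) - (\<Sum>i=0..k. (\<tau> i)\<^sup>2 * (vtx i \<bullet> v))"
      by (simp add: s_def sum_distrib_right sum_subtractf right_diff_distrib)
    then have "(\<Sum>i=0..k. (\<tau> i)\<^sup>2 * (x0 \<bullet> v - vtx i \<bullet> v)) = 0"
      using x0v by simp
    then have "\<forall>i\<in>{0..k}. (\<tau> i)\<^sup>2 * (x0 \<bullet> v - vtx i \<bullet> v) = 0"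
      using le k by (subst (asm) sum_nonneg_eq_0_iff) auto
    then have "vtx i \<bullet> v = x0 \<bullet> v" if "i \<in> {0..k}" for i
      using \<tau>_pos[of i] that k by fastforce
    with le show "v \<in> ?R"
      by auto
  next
    assume v: "v \<in> ?R"
    have "vtx i \<bullet> v \<le> x0 \<bullet> v" if "i \<le> d" for i
      using v that by (cases "i \<le> k") auto
    then have "S \<subseteq> {z. v \<bullet> z \<le> v \<bullet> x0}"
      unfolding S_def by (intro hull_minimal convex_halfspace_le) (auto simp: inner_commute)
    then show "\<forall>z\<in>S. v \<bullet> (z - x0) \<le> 0"
      by (auto simp: inner_diff_right)
  qed
  then show ?thesis
    unfolding normal_cone_eq[OF convex_F F_subset_S x0_rel_interior] by blast
qed

section \<open>Orthogonal decompositions of the cones\<close>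

lemma e_tgen: "i \<in> {k<..d} \<Longrightarrow> j \<in> {k<..d} \<Longrightarrow> e i \<bullet> tgen j = (if i = j then 1 / \<tau> i else 0)"
  by (simp add: tgen_def inner_diff_right e_vtx e_x0)

lemma e_tgen_sum: "i \<in> {k<..d} \<Longrightarrow> e i \<bullet> (\<Sum>j\<in>{k<..d}. c j *\<^sub>R tgen j) = c i / \<tau> i"
  by (simp add: inner_sum_right e_tgen if_distrib[of "\<lambda>t. _ * t"] cong: if_cong)

lemma w_tgen_sum: "w \<bullet> (\<Sum>j\<in>{k<..d}. c j *\<^sub>R tgen j) = 0"
  by (simp add: inner_sum_right w_tgen)

lemma tangent_cone_decomposition:
  "orthogonal_direct_sum (tangent_cone F S) L (convex_cone hull (tgen ` {k<..d}))"
  unfolding orthogonal_direct_sum_def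
proof (intro conjI ballI)
  fix x y assume x: "x \<in> L" and "y \<in> convex_cone hull (tgen ` {k<..d})"
  then obtain c where y: "y = (\<Sum>j\<in>{k<..d}. c j *\<^sub>R tgen j)"
    by (auto simp: convex_cone_hull_image)
  have "x0 \<bullet> x = 0"
    using x w_inner_k[of x] by (simp add: L_def x0_inner)
  then have "x \<bullet> tgen j = 0" if "j \<in> {k<..d}" for j
    using x that by (simp add: L_def tgen_def inner_diff_right vtx_def inner_commute)
  then show "orthogonal x y"
    by (simp add: y orthogonal_def inner_sum_right)
next
  show "tangent_cone F S = {x + y |x y. x \<in> L \<and> y \<in> convex_cone hull (tgen ` {k<..d})}"
  proof (intro equalityI subsetI)
    fix v assume v: "v \<in> tangent_cone F S"
    \<comment> \<open>The coefficients are chosen so that \<open>y\<close> and \<open>v\<close> have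
      the same coordinates beyond \<open>k\<close>, which puts \<open>v - y\<close> into
      \<open>L\<close>.\<close>
    define y where "y = (\<Sum>j\<in>{k<..d}. (\<tau> j * (e j \<bullet> v)) *\<^sub>R tgen j)"
    have "y \<in> convex_cone hull (tgen ` {k<..d})"
      using v \<tau>_pos unfolding y_def convex_cone_hull_image[OF finite_greaterThanAtMost]
      by (auto simp: tangent_cone_F less_imp_le intro!: exI[of _ "\<lambda>j. \<tau> j * (e j \<bullet> v)"])
    moreover have "v - y \<in> L"
      using v \<tau>_pos by (auto simp: L_def tangent_cone_F y_def inner_diff_right w_tgen_sum e_tgen_sum less_imp_neq[symmetric])
    ultimately show "v \<in> {x + y |x y. x \<in> L \<and> y \<in> convex_cone hull (tgen ` {k<..d})}"
      by (intro CollectI exI[of _ "v - y"] exI[of _ y]) auto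
  next
    fix v assume "v \<in> {x + y |x y. x \<in> L \<and> y \<in> convex_cone hull (tgen ` {k<..d})}"
    then obtain x c where "x \<in> L" "v = x + (\<Sum>j\<in>{k<..d}. c j *\<^sub>R tgen j)" "\<forall>j\<in>{k<..d}. 0 \<le> c j"
      by (auto simp: convex_cone_hull_image)
    then show "v \<in> tangent_cone F S"
      using \<tau>_pos by (auto simp: tangent_cone_F L_def inner_add_right w_tgen_sum e_tgen_sum less_imp_le)
  qed
qed

text \<open>The coordinates beyond \<open>k\<close> are nonnegative on the cone, hence constant
  along any line in it. They also determine the points of the cone, so the line collapses.\<close>

lemma pointed_tgen: "pointed_cone (convex_cone hull (tgen ` {k<..d}))"
  unfolding pointed_cone_def
proof (intro conjI notI)
  assume "\<exists>x v. v \<noteq> 0 \<and> (\<forall>t. x + t *\<^sub>R v \<in> convex_cone hull (tgen ` {k<..d}))"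
  then obtain x v where "v \<noteq> 0" and line: "\<And>t. x + t *\<^sub>R v \<in> convex_cone hull (tgen ` {k<..d})"
    by blast
  have cone: "0 \<le> e j \<bullet> y" "y = (\<Sum>j\<in>{k<..d}. (\<tau> j * (e j \<bullet> y)) *\<^sub>R tgen j)"
    if y: "y \<in> convex_cone hull (tgen ` {k<..d})" and j: "j \<in> {k<..d}" for y j
  proof -
    obtain c where c: "y = (\<Sum>j\<in>{k<..d}. c j *\<^sub>R tgen j)" "\<forall>j\<in>{k<..d}. 0 \<le> c j"
      using y by (auto simp: convex_cone_hull_image)
    then have ey: "e j \<bullet> y = c j / \<tau> j" if "j \<in> {k<..d}" for j
      using e_tgen_sum[OF that] by simp
    then show "0 \<le> e j \<bullet> y"
      using c(2) j \<tau>_pos[of j] by simp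
    have "(\<tau> j * (e j \<bullet> y)) = c j" if "j \<in> {k<..d}" for j
      using ey[OF that] \<tau>_pos[of j] that by simp
    then show "y = (\<Sum>j\<in>{k<..d}. (\<tau> j * (e j \<bullet> y)) *\<^sub>R tgen j)"
      using c(1) by simp
  qed
  show False
  proof (cases "k < d")
    case True
    have ev: "e j \<bullet> v = 0" if j: "j \<in> {k<..d}" for j
    proof (rule ccontr)
      assume "e j \<bullet> v \<noteq> 0"
      then show False
        \<comment> \<open>At this parameter the coordinate on the line equals -1.\<close>
        using cone(1)[OF line[of "- ((e j \<bullet> x) + 1) / (e j \<bullet> v)"] j] by (simp add: inner_add_right)
    qed
    have "x + 1 *\<^sub>R v = (\<Sum>j\<in>{k<..d}. (\<tau> j * (e j \<bullet> (x + 1 *\<^sub>R v))) *\<^sub>R tgen j)"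
      using True by (intro cone(2)[of _ d] line) simp
    also have "\<dots> = (\<Sum>j\<in>{k<..d}. (\<tau> j * (e j \<bullet> (x + 0 *\<^sub>R v))) *\<^sub>R tgen j)"
      by (simp add: inner_add_right ev)
    also have "\<dots> = x + 0 *\<^sub>R v"
      using True by (intro cone(2)[of _ d, symmetric] line) simp
    finally have "x + 1 *\<^sub>R v = x + 0 *\<^sub>R v" .
    with \<open>v \<noteq> 0\<close> show False
      by simp
  next
    case False
    then have "x + t *\<^sub>R v = 0" for t
      using line[of t] by simp
    from this[of 0] this[of 1] \<open>v \<noteq> 0\<close> show False
      by simp
  qed
qed (rule convex_cone_convex_cone_hull)

lemma x0_ngen: "j \<in> {k<..d} \<Longrightarrow> x0 \<bullet> ngen j = 1 / \<sigma>"
  by (simp add: ngen_def inner_diff_right inner_table)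

lemma vtx_ngen: "i \<le> d \<Longrightarrow> j \<in> {k<..d} \<Longrightarrow> vtx i \<bullet> ngen j = 1 / \<sigma> - (if i = j then 1 / (\<tau> i)\<^sup>2 else 0)"
  by (simp add: ngen_def inner_diff_right inner_table)

lemma normal_cone_decomposition:
  "orthogonal_direct_sum (normal_cone F S) (span {w}) (convex_cone hull (ngen ` {k<..d}))"
  unfolding orthogonal_direct_sum_def
proof (intro conjI ballI)
  fix x y assume x: "x \<in> span {w}" and "y \<in> convex_cone hull (ngen ` {k<..d})"
  then obtain r c where "x = r *\<^sub>R w" "y = (\<Sum>j\<in>{k<..d}. c j *\<^sub>R ngen j)"
    by (auto simp: convex_cone_hull_image span_singleton)
  then show "orthogonal x y"
    by (simp add: orthogonal_def inner_sum_right w_ngen)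
next
  show "normal_cone F S = {x + y |x y. x \<in> span {w} \<and> y \<in> convex_cone hull (ngen ` {k<..d})}"
  proof (intro equalityI subsetI)
    fix v assume v: "v \<in> normal_cone F S"
    define c where "c = x0 \<bullet> v"
    \<comment> \<open>Forced by pairing with \<open>x0\<close> and \<open>vtx j\<close>: in
      \<open>r *\<^sub>R w + y\<close> the two values differ by
      \<open>a j / (\<tau> j)\<^sup>2\<close>, and the value at \<open>x0\<close> is
      \<open>r + sum a {k<..d} / \<sigma>\<close>, which also gives the coefficient of
      \<open>w\<close>.\<close>
    define a where "a j = (\<tau> j)\<^sup>2 * (c - vtx j \<bullet> v)" for j
    define y where "y = (\<Sum>j\<in>{k<..d}. a j *\<^sub>R ngen j)"
    have "0 \<le> a j" if "j \<in> {k<..d}" for j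
      using v that by (simp add: normal_cone_F a_def c_def)
    then have "y \<in> convex_cone hull (ngen ` {k<..d})"
      unfolding y_def convex_cone_hull_image[OF finite_greaterThanAtMost] by blast
    moreover have "v = (c - sum a {k<..d} / \<sigma>) *\<^sub>R w + y"
    proof (rule coordinate_eqI)
      fix i assume i: "i \<le> d"
      have ev: "e i \<bullet> v = \<tau> i * (vtx i \<bullet> v)"
        using \<tau>_pos[OF i] by (simp add: vtx_def)
      have "e i \<bullet> y = (\<Sum>j\<in>{k<..d}. a j * \<tau> i / \<sigma> - (if i = j then a i / \<tau> i else 0))"
        unfolding y_def inner_sum_right using i
        by (intro sum.cong) (auto simp: ngen_def inner_diff_right e_w e_vtx right_diff_distrib)
      also have "\<dots> = sum a {k<..d} * \<tau> i / \<sigma> - (if i \<in> {k<..d} then a i / \<tau> i else 0)"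
        by (simp add: sum_subtractf sum_distrib_right sum_divide_distrib)
      also have "(if i \<in> {k<..d} then a i / \<tau> i else 0) = \<tau> i * c - e i \<bullet> v"
      proof (cases "i \<in> {k<..d}")
        case True
        then show ?thesis
          using \<tau>_pos[OF i] by (simp add: a_def ev power2_eq_square field_simps)
      next
        case False
        then show ?thesis
          using v i by (simp add: normal_cone_F ev c_def)
      qed
      finally show "e i \<bullet> v = e i \<bullet> ((c - sum a {k<..d} / \<sigma>) *\<^sub>R w + y)"
        using i by (simp add: inner_add_right e_w algebra_simps)
    qed
    ultimately show "v \<in> {x + y |x y. x \<in> span {w} \<and> y \<in> convex_cone hull (ngen ` {k<..d})}"
      by (intro CollectI exI[of _ "(c - sum a {k<..d} / \<sigma>) *\<^sub>R w"] exI[of _ y]) (auto simp: span_mul span_base)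
  next
    fix v assume "v \<in> {x + y |x y. x \<in> span {w} \<and> y \<in> convex_cone hull (ngen ` {k<..d})}"
    then obtain r c where v: "v = r *\<^sub>R w + (\<Sum>j\<in>{k<..d}. c j *\<^sub>R ngen j)" and c: "\<forall>j\<in>{k<..d}. 0 \<le> c j"
      by (auto simp: convex_cone_hull_image span_singleton)
    have x: "x0 \<bullet> v = r + (\<Sum>j\<in>{k<..d}. c j / \<sigma>)"
      by (simp add: v inner_add_right inner_sum_right inner_table x0_ngen)
    have y: "vtx i \<bullet> v = r + (\<Sum>j\<in>{k<..d}. c j / \<sigma>) - (if i \<in> {k<..d} then c i / (\<tau> i)\<^sup>2 else 0)" if "i \<le> d" for i
    proof -
      have "(\<Sum>j\<in>{k<..d}. c j * (vtx i \<bullet> ngen j)) = (\<Sum>j\<in>{k<..d}. c j / \<sigma> - (if i = j then c i / (\<tau> i)\<^sup>2 else 0))"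
        using that by (intro sum.cong) (auto simp: vtx_ngen right_diff_distrib)
      then show ?thesis
        using that by (simp add: v inner_add_right inner_sum_right inner_table sum_subtractf)
    qed
    show "v \<in> normal_cone F S"
      using k c by (auto simp: normal_cone_F x y)
  qed
qed

section \<open>Angles as Gaussian orthant probabilities\<close>

lemma w_nonzero: "w \<noteq> 0"
  using w_w \<sigma>_pos by auto

text \<open>Only one term of the sum survives, and it is negative. The sum of one family is the
  strictly feasible point \<open>p\<close> that \<open>solid_angle_eq_g_fun\<close> requires for the
  other.\<close>

lemma tgen_ngen_sum: "i \<in> {k<..d} \<Longrightarrow> tgen i \<bullet> (\<Sum>j\<in>{k<..d}. ngen j) < 0" "i \<in> {k<..d} \<Longrightarrow> ngen i \<bullet> (\<Sum>j\<in>{k<..d}. tgen j) < 0"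
  using \<tau>_pos[of i] by (simp_all add: inner_sum_right inner_commute[of "ngen i"] tgen_ngen cong: if_cong)

lemma ball_shift: "(\<forall>i\<in>{1..d - k}. P (k + i)) \<longleftrightarrow> (\<forall>j\<in>{k<..d}. P j)"
  unfolding image_shift_gt[OF k, symmetric] by blast

lemma shift_mem: "i \<in> {1..d - k} \<Longrightarrow> k + i \<in> {k<..d}"
  using k by auto

text \<open>On the hyperplane \<open>w \<bullet> v = 0\<close> the product with
  \<open>ngen j\<close> is \<open>- (vtx j \<bullet> v)\<close>, so the coordinate inequalities of
  the tangent cone become inequalities for the \<open>ngen j\<close>, whose Gram matrix has the
  parameter \<open>- \<sigma>\<close>.\<close>

lemma internal_angle_F: "internal_angle F S = g_fun (d - k) (- \<sigma>) (\<lambda>i. (\<tau> (k + i))\<^sup>2) (\<lambda>_. 1)"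
proof -
  have "ngen j \<bullet> v \<le> 0 \<longleftrightarrow> 0 \<le> e j \<bullet> v" if "j \<in> {k<..d}" "w \<bullet> v = 0" for j v
    using that \<tau>_pos[of j] by (simp add: ngen_def inner_diff_left vtx_def zero_le_divide_iff)
  then have T: "tangent_cone F S = {v\<in>{v. w \<bullet> v = 0}. \<forall>i\<in>{1..d - k}. ngen (k + i) \<bullet> v \<le> 0}"
    unfolding tangent_cone_F ball_shift[of "\<lambda>j. ngen j \<bullet> _ \<le> 0"] by auto
  show ?thesis
    unfolding internal_angle_def T
  proof (rule solid_angle_eq_g_fun[OF subspace_hyperplane])
    show "(\<Sum>j\<in>{k<..d}. tgen j) \<in> {v. w \<bullet> v = 0}"
      by (simp add: inner_sum_right w_tgen)
  qed (auto dest!: shift_mem simp: w_ngen tgen_ngen_sum ngen_ngen orthocentric_gram_def)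
qed

lemma external_angle_F: "external_angle F S = g_fun (d - k) s (\<lambda>i. (\<tau> (k + i))\<^sup>2) (\<lambda>_. 1)"
proof -
  \<comment> \<open>The orthogonal complement of \<open>L\<close>. It contains both families of
    generators.\<close>
  define V where "V = {v. \<forall>i\<in>{0..k}. vtx i \<bullet> v = x0 \<bullet> v}"
  have V: "subspace V"
    by (auto simp: V_def subspace_def inner_add_right)
  have tV: "tgen j \<in> V" and nV: "ngen j \<in> V" if "j \<in> {k<..d}" for j
    using that k by (auto simp: V_def x0_ngen vtx_ngen tgen_def inner_diff_right inner_table)
  have N: "normal_cone F S = {v\<in>V. \<forall>i\<in>{1..d - k}. tgen (k + i) \<bullet> v \<le> 0}"
    unfolding normal_cone_F V_def ball_shift[of "\<lambda>j. tgen j \<bullet> _ \<le> 0"] by (simp add: tgen_def inner_diff_left)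
  show ?thesis
    unfolding external_angle_def N
  proof (rule solid_angle_eq_g_fun[OF V])
    show "(\<Sum>j\<in>{k<..d}. ngen j) \<in> V"
      by (intro subspace_sum V nV)
  qed (auto dest!: shift_mem simp: tV tgen_ngen_sum tgen_tgen orthocentric_gram_def)
qed

end

theorem theorem5p4:
  fixes d k :: nat and \<tau> :: "nat \<Rightarrow> real"
    and e :: "nat \<Rightarrow> real ^ 'n" and S F :: "(real ^ 'n) set"
  assumes "d \<ge> 2" and "CARD('n) = d + 1"
    and "\<And>i. i \<le> d \<Longrightarrow> \<tau> i > 0"
    and "bij_betw e {0..d} Basis"
    and "S = convex hull ((\<lambda>i. (1 / \<tau> i) *\<^sub>R e i) ` {0..d})"
    and "k \<le> d"
    and "F = convex hull ((\<lambda>i. (1 / \<tau> i) *\<^sub>R e i) ` {0..k})"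
  shows "(F face_of S \<and> aff_dim F = int k) \<and>
    ((k < d \<longrightarrow>
        dim (lineality_space F) = k \<and>
        (\<exists>D. orthogonal_direct_sum (tangent_cone F S) (lineality_space F) D \<and>
             pointed_cone D \<and>
             (\<exists>C :: (real ^ 'n) set.
                orthocentric_cone (d - k) (\<Sum>i=0..k. (\<tau> i)\<^sup>2) (\<lambda>i. (\<tau> (k + i))\<^sup>2) (\<lambda>_. 1) C \<and>
                isometric_cones D C))) \<and>
     (k = d \<longrightarrow> tangent_cone F S = lineality_space S)) \<and>
    ((k < d \<longrightarrow>
        (\<exists>v D. v \<noteq> 0 \<and>
             orthogonal_direct_sum (normal_cone F S) (span {v}) D \<and>
             (\<exists>C :: (real ^ 'n) set.
                orthocentric_cone (d - k) (- (\<Sum>i=0..d. (\<tau> i)\<^sup>2)) (\<lambda>i. (\<tau> (k + i))\<^sup>2) (\<lambda>_. 1) C \<and>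
                isometric_cones D C))) \<and>
     (k = d \<longrightarrow> (\<exists>v. v \<noteq> 0 \<and> normal_cone F S = span {v}))) \<and>
    internal_angle F S =
      g_fun (d - k) (- (\<Sum>i=0..d. (\<tau> i)\<^sup>2)) (\<lambda>i. (\<tau> (k + i))\<^sup>2) (\<lambda>_. 1) \<and>
    external_angle F S =
      g_fun (d - k) (\<Sum>i=0..k. (\<tau> i)\<^sup>2) (\<lambda>i. (\<tau> (k + i))\<^sup>2) (\<lambda>_. 1)"
proof -
  interpret X: orthogonal_simplex d k \<tau> e
    using assms(3,4,6) by unfold_locales auto
  have S: "S = X.S" and F: "F = X.F"
    using assms(5,7) by (simp_all add: X.S_def X.F_def X.vtx_def[abs_def])
  \<comment> \<open>For \<open>k = d\<close> no generators remain: their hull is the zero cone and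
    the normal cone reduces to the line through \<open>X.w\<close>.\<close>
  have eq: "S = F" "X.L = tangent_cone F S" "normal_cone F S = span {X.w}" if "k = d"
  proof -
    show "S = F"
      using that assms(5,7) by simp
    show "X.L = tangent_cone F S"
      using that unfolding S F X.tangent_cone_F X.L_def by simp
    show "normal_cone F S = span {X.w}"
      using that X.normal_cone_decomposition unfolding S F orthogonal_direct_sum_def by simp
  qed
  \<comment> \<open>The cone generated by the \<open>tgen j\<close> is itself a realisation of the
    orthocentric cone, so the identity serves as the isometry; likewise for the
    \<open>ngen j\<close> below.\<close>
  have "\<exists>D. orthogonal_direct_sum (tangent_cone F S) (lineality_space F) D \<and> pointed_cone D \<and>
      (\<exists>C :: (real ^ 'n) set.
        orthocentric_cone (d - k) (\<Sum>i=0..k. (\<tau> i)\<^sup>2) (\<lambda>i. (\<tau> (k + i))\<^sup>2) (\<lambda>_. 1) C \<and> isometric_cones D C)"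
    if "k < d"
    using X.tangent_cone_decomposition X.pointed_tgen X.orthocentric_cone_gens(1)[OF that] isometric_cones_refl
    unfolding S F X.lineality_space_F X.s_def by blast
  moreover have "\<exists>v D. v \<noteq> 0 \<and> orthogonal_direct_sum (normal_cone F S) (span {v}) D \<and>
      (\<exists>C :: (real ^ 'n) set.
        orthocentric_cone (d - k) (- (\<Sum>i=0..d. (\<tau> i)\<^sup>2)) (\<lambda>i. (\<tau> (k + i))\<^sup>2) (\<lambda>_. 1) C \<and> isometric_cones D C)"
    if "k < d"
    using X.w_nonzero X.normal_cone_decomposition X.orthocentric_cone_gens(2)[OF that] isometric_cones_refl
    unfolding S F X.\<sigma>_def by blast
  moreover have "tangent_cone F S = lineality_space S" if "k = d"
    using eq(2)[OF that] X.lineality_space_F F eq(1)[OF that] by simp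
  moreover have "\<exists>v. v \<noteq> 0 \<and> normal_cone F S = span {v}" if "k = d"
    using eq(3)[OF that] X.w_nonzero by blast
  moreover have "F face_of S" "aff_dim F = int k" "dim (lineality_space F) = k"
    using X.F_face X.aff_dim_F X.dim_L X.lineality_space_F by (simp_all add: S F)
  ultimately show ?thesis
    using X.internal_angle_F X.external_angle_F unfolding S F X.s_def X.\<sigma>_def by (intro conjI impI) blast+
qed

end
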